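(* Let $N \geq 1$ and let $F:\mathbb{R}^{2N}\to\mathbb{R}$ be of class $C^2(\mathbb{R}^{2N})$. Suppose that there are constants $M,\lambda,\Lambda>0$ and an exponent $\mu>1$ such that for all $Y,Z\in\mathbb{R}^{2N}$ $$|\nabla F(Z)|\leq M,$$ $$\lambda(1+|Z|)^{-\mu}|Y|^2\leq D^2F(Z)(Y,Y)\leq \Lambda(1+|Z|)^{-1}|Y|^2 .$$ Let $u\in C^2(\mathbb{R}^2,\mathbb{R}^N)$ be a solution of $$\operatorname{div}\big[\nabla F(\nabla u)\big]=0\quad\text{on }\mathbb{R}^2 .$$ Then the following hold. (a) If $\displaystyle\lim_{|x|\to\infty}\frac{|u(x)|}{|x|}=0$, then $u$ is a constant function. (b) If $\displaystyle\sup_{x\in\mathbb{R}^2}|\nabla u(x)|<\infty$, then $u$ is affine. (c) If $\displaystyle\limsup_{|x|\to\infty}\frac{|u(x)|}{|x|}<\infty$, then $u$ is affine.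
   Context: The gradient (Jacobian) $\nabla u(x)$ of $u:\mathbb{R}^2\to\mathbb{R}^N$ is regarded as an element $(\partial_\alpha u^i)_{1\le i\le N,\,\alpha=1,2}$ of $\mathbb{R}^{2N}$, and $|\cdot|$ denotes the Euclidean norm. $\nabla F$ is the gradient of $F$ on $\mathbb{R}^{2N}$ and $D^2F(Z)(\cdot,\cdot)$ is the bilinear form given by the second derivative of $F$ at $Z$. The equation $\operatorname{div}[\nabla F(\nabla u)]=0$ is the system $\sum_{\alpha=1}^2\partial_\alpha\Big[\frac{\partial F}{\partial Z^i_\alpha}(\nabla u)\Big]=0$ for $i=1,\dots,N$. "Affine" means $u(x)=Ax+a$ for some $A\in\mathbb{R}^{2N}$ (viewed as an $N\times 2$ matrix) and some $a\in\mathbb{R}^N$. *)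

theory Defs
  imports "HOL-Analysis.Analysis"
begin

definition C2 :: "('a::real_normed_vector \<Rightarrow> 'b::real_normed_vector) \<Rightarrow> bool" where
  "C2 f \<longleftrightarrow>
     (\<exists>(f' :: 'a \<Rightarrow> 'a \<Rightarrow>\<^sub>L 'b) (f'' :: 'a \<Rightarrow> 'a \<Rightarrow>\<^sub>L ('a \<Rightarrow>\<^sub>L 'b)).
        (\<forall>x. (f has_derivative blinfun_apply (f' x)) (at x)) \<and>
        (\<forall>x. (f' has_derivative blinfun_apply (f'' x)) (at x)) \<and>
        continuous_on UNIV f'')"

(* The gradient with respect to the inner product.  On real^2^'n, the N x 2 matrices with
   N = CARD('n), inner product and norm are the Euclidean ones of the 2N entries, so that
   grad F Z $ i $ \<alpha> is the partial derivative of F in the entry Z $ i $ \<alpha>. *)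
definition grad :: "('a::real_inner \<Rightarrow> real) \<Rightarrow> 'a \<Rightarrow> 'a" where
  "grad F Z = (THE D. GDERIV F Z :> D)"

(* D2 F Z Y W is the derivative at Z, in direction Y, of the derivative of F in direction W. *)
definition D2 :: "('a::real_normed_vector \<Rightarrow> real) \<Rightarrow> 'a \<Rightarrow> 'a \<Rightarrow> 'a \<Rightarrow> real" where
  "D2 F Z Y W = frechet_derivative (\<lambda>X. frechet_derivative F (at X) W) (at Z) Y"

definition partial :: "'m::finite \<Rightarrow> (real^'m \<Rightarrow> real) \<Rightarrow> real^'m \<Rightarrow> real" where
  "partial \<alpha> g x = frechet_derivative g (at x) (axis \<alpha> 1)"

(* Row-wise divergence of a matrix field. *)
definition divergence :: "(real^'m::finite \<Rightarrow> real^'m^'n::finite) \<Rightarrow> real^'m \<Rightarrow> real^'n" where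
  "divergence V x = (\<chi> i. \<Sum>\<alpha>\<in>UNIV. partial \<alpha> (\<lambda>y. V y $ i $ \<alpha>) x)"

(* The gradient matrix (\<partial>\<^sub>\<alpha> u\<^sup>i), row index i and column index \<alpha>. *)
abbreviation nabla :: "(real^'m::finite \<Rightarrow> real^'n::finite) \<Rightarrow> real^'m \<Rightarrow> real^'m^'n" where
  "nabla u x \<equiv> jacobian u (at x)"

definition affine_map :: "(real^'m::finite \<Rightarrow> real^'n::finite) \<Rightarrow> bool" where
  "affine_map u \<longleftrightarrow> (\<exists>A a. \<forall>x. u x = A *v x + a)"

end

theory Submission
  imports Defs
begin

text \<open>The three parts reduce to one: a solution of linear growth, \<open>|u x| \<le> c (1 + |x|)\<close>, is affine.  The limsup
in the third part is finite exactly for such \<open>u\<close>; bounded \<open>\<nabla>u\<close> gives linear growth by the mean value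
inequality; and sublinear growth gives an affine \<open>u\<close> whose linear part must vanish.

Let \<open>\<eta>\<close> be a cutoff function that is \<open>1\<close> on the ball \<open>B\<^sub>R\<close>, vanishes outside \<open>B\<^sub>2\<^sub>R\<close> and has
\<open>|\<nabla>\<eta>| \<le> 16/R\<close>.  Two test functions do the work.

(1) Testing \<open>div [\<nabla>F(\<nabla>u) - \<nabla>F(0)] = 0\<close> with \<open>\<eta>\<^sup>2 u\<close>, boundedness of \<open>\<nabla>F\<close> and linear growth of \<open>u\<close>
bound \<open>\<integral> \<eta>\<^sup>2 (\<nabla>F(\<nabla>u) - \<nabla>F(0)) \<bullet> \<nabla>u\<close> by a multiple of the area \<open>R\<^sup>2\<close>.  The lower ellipticity bound
makes the integrand dominate \<open>|\<nabla>u|\<close> up to a constant (\<open>G_coercive\<close>), so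
\<open>\<integral>\<^bsub>B(R)\<^esub> |\<nabla>u| \<le> K R\<^sup>2\<close> (\<open>gradient_integral_growth\<close>).

(2) Testing the equation differentiated in a unit direction \<open>e\<close> with \<open>\<eta>\<^sup>2 \<partial>\<^sub>e u\<close> gives a Caccioppoli
inequality for \<open>Q = D\<^sup>2F(\<nabla>u)(\<partial>\<^sub>e\<nabla>u, \<partial>\<^sub>e\<nabla>u) \<ge> 0\<close>.  By Young's inequality for the form \<open>D\<^sup>2F(\<nabla>u)\<close> and its
upper bound, for every \<open>\<delta> > 0\<close>,
\<open>\<integral> \<eta>\<^sup>2 Q \<le> 1/\<delta> \<integral>\<^bsub>|x| > R\<^esub> \<eta>\<^sup>2 Q + \<delta> \<Lambda> \<integral> |\<nabla>\<eta>|\<^sup>2 |\<nabla>u|\<close>.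
In two dimensions the last integral is bounded uniformly in \<open>R\<close> by (1).  Taking \<open>\<delta> = 2\<close> shows that \<open>Q\<close> is
integrable; then the first term on the right tends to \<open>0\<close> as \<open>R\<close> grows, and letting \<open>\<delta>\<close> tend to \<open>0\<close> gives
\<open>Q = 0\<close> (\<open>doubling_absorption\<close>).  Since the form is definite, \<open>\<partial>\<^sub>e\<nabla>u = 0\<close>
(\<open>second_derivatives_vanish\<close>).

As \<open>u\<close> is only of class \<open>C\<^sup>2\<close>, the equation cannot be differentiated pointwise.  The differentiated weak
equation (\<open>differentiated_weak_equation\<close>) is obtained from difference quotients by dominated convergence.\<close>

section \<open>Continuously differentiable maps\<close>

text \<open>\<open>f'\<close> is the Frechet derivative of \<open>f\<close>, and \<open>f\<close> is of class \<open>C\<^sup>1\<close>.  The derivative is kept as a plain curried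
function; in finite dimension its continuity amounts to continuity of every directional derivative.\<close>

definition C1_deriv :: "('a::euclidean_space \<Rightarrow> 'b::euclidean_space) \<Rightarrow> ('a \<Rightarrow> 'a \<Rightarrow> 'b) \<Rightarrow> bool" where
  "C1_deriv f f' \<longleftrightarrow>
     (\<forall>x. (f has_derivative f' x) (at x)) \<and> (\<forall>v. continuous_on UNIV (\<lambda>x. f' x v))"

lemma C1_derivI:
  assumes "\<And>x. (f has_derivative f' x) (at x)" "\<And>v. continuous_on UNIV (\<lambda>x. f' x v)"
  shows "C1_deriv f f'"
  using assms by (simp add: C1_deriv_def)

lemma C1_deriv_has_derivative: "C1_deriv f f' \<Longrightarrow> (f has_derivative f' x) (at x)"
  by (simp add: C1_deriv_def)

lemma C1_deriv_linear: "C1_deriv f f' \<Longrightarrow> linear (f' x)"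
  by (meson C1_deriv_has_derivative has_derivative_linear)

lemma C1_deriv_continuous_deriv: "C1_deriv f f' \<Longrightarrow> continuous_on UNIV (\<lambda>x. f' x v)"
  by (simp add: C1_deriv_def)

lemma C1_deriv_continuous: "C1_deriv f f' \<Longrightarrow> continuous_on UNIV f"
  by (meson C1_deriv_has_derivative has_derivative_continuous continuous_at_imp_continuous_on)

lemma C1_deriv_compose:
  assumes f: "C1_deriv f f'" and g: "C1_deriv g g'"
  shows "C1_deriv (\<lambda>x. g (f x)) (\<lambda>x v. g' (f x) (f' x v))"
proof (rule C1_derivI)
  show "((\<lambda>x. g (f x)) has_derivative (\<lambda>v. g' (f x) (f' x v))) (at x)" for x
    using diff_chain_at[OF C1_deriv_has_derivative[OF f] C1_deriv_has_derivative[OF g]]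
    by (simp add: o_def)
  show "continuous_on UNIV (\<lambda>x. g' (f x) (f' x v))" for v
  proof -
    have eq: "g' (f x) (f' x v) = (\<Sum>b\<in>Basis. (f' x v \<bullet> b) *\<^sub>R g' (f x) b)" for x
    proof -
      have "g' (f x) (f' x v) = g' (f x) (\<Sum>b\<in>Basis. (f' x v \<bullet> b) *\<^sub>R b)"
        by (simp add: euclidean_representation)
      then show ?thesis
        using C1_deriv_linear[OF g] by (simp add: linear_sum linear_cmul)
    qed
    have "continuous_on UNIV (\<lambda>x. g' (f x) b)" for b
      by (rule continuous_on_compose2[OF C1_deriv_continuous_deriv[OF g] C1_deriv_continuous[OF f]]) simp
    then show ?thesis
      unfolding eq by (intro continuous_intros C1_deriv_continuous_deriv[OF f])
  qed
qed

lemma C1_deriv_bounded_linear: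
  assumes L: "bounded_linear L" and f: "C1_deriv f f'"
  shows "C1_deriv (\<lambda>x. L (f x)) (\<lambda>x v. L (f' x v))"
  by (intro C1_derivI bounded_linear.has_derivative[OF L] C1_deriv_has_derivative[OF f]
      bounded_linear.continuous_on[OF L] C1_deriv_continuous_deriv[OF f])

lemma C1_deriv_bounded_bilinear:
  assumes B: "bounded_bilinear B" and f: "C1_deriv f f'" and g: "C1_deriv g g'"
  shows "C1_deriv (\<lambda>x. B (f x) (g x)) (\<lambda>x v. B (f x) (g' x v) + B (f' x v) (g x))"
  by (intro C1_derivI bounded_bilinear.FDERIV[OF B] C1_deriv_has_derivative[OF f]
      C1_deriv_has_derivative[OF g] continuous_intros bounded_bilinear.continuous_on[OF B]
      C1_deriv_continuous_deriv[OF f] C1_deriv_continuous_deriv[OF g]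
      C1_deriv_continuous[OF f] C1_deriv_continuous[OF g])

lemma C1_deriv_diff:
  assumes f: "C1_deriv f f'" and g: "C1_deriv g g'"
  shows "C1_deriv (\<lambda>x. f x - g x) (\<lambda>x v. f' x v - g' x v)"
  by (intro C1_derivI derivative_intros C1_deriv_has_derivative[OF f]
      C1_deriv_has_derivative[OF g] continuous_intros
      C1_deriv_continuous_deriv[OF f] C1_deriv_continuous_deriv[OF g])

lemma C1_deriv_translate:
  assumes f: "C1_deriv f f'"
  shows "C1_deriv (\<lambda>x. f (x + c)) (\<lambda>x. f' (x + c))"
proof -
  have "C1_deriv (\<lambda>x. x + c) (\<lambda>x v. v)"
    by (intro C1_derivI) (auto intro!: derivative_eq_intros)
  from C1_deriv_compose[OF this f] show ?thesis by simp
qed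

lemma C1_deriv_sum:
  assumes "\<And>i. i \<in> S \<Longrightarrow> C1_deriv (f i) (f' i)"
  shows "C1_deriv (\<lambda>x. \<Sum>i\<in>S. f i x) (\<lambda>x v. \<Sum>i\<in>S. f' i x v)"
  by (intro C1_derivI has_derivative_sum continuous_on_sum)
    (use assms in \<open>auto simp: C1_deriv_def\<close>)

section \<open>Difference quotients and integration\<close>

text \<open>The forward difference quotient of \<open>f\<close> in direction \<open>e\<close> with step \<open>1/(n+1)\<close>.\<close>

definition diffquot :: "('a::real_vector \<Rightarrow> 'b::real_vector) \<Rightarrow> 'a \<Rightarrow> nat \<Rightarrow> 'a \<Rightarrow> 'b" where
  "diffquot f e n x = real (Suc n) *\<^sub>R (f (x + inverse (real (Suc n)) *\<^sub>R e) - f x)"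

lemma C1_deriv_diffquot:
  assumes f: "C1_deriv f f'"
  shows "C1_deriv (diffquot f e n) (\<lambda>x v. diffquot (\<lambda>y. f' y v) e n x)"
  unfolding diffquot_def
  by (intro C1_deriv_bounded_linear[OF bounded_linear_scaleR_right]
      C1_deriv_diff C1_deriv_translate f)

lemma diffquot_tendsto:
  assumes f: "C1_deriv f f'"
  shows "(\<lambda>n. diffquot f e n x) \<longlonglongrightarrow> f' x e"
proof -
  define g where "g t = f (x + t *\<^sub>R e)" for t :: real
  have l: "((\<lambda>t. x + t *\<^sub>R e) has_derivative (\<lambda>t. t *\<^sub>R e)) (at 0)"
    by (auto intro!: derivative_eq_intros)
  have "(f has_derivative f' x) (at (x + 0 *\<^sub>R e))"
    using C1_deriv_has_derivative[OF f] by simp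
  from diff_chain_at[OF l this] have "(g has_derivative (\<lambda>t. f' x (t *\<^sub>R e))) (at 0)"
    by (simp add: g_def[abs_def] o_def)
  then have "(g has_vector_derivative f' x e) (at 0)"
    by (simp add: has_vector_derivative_def linear_cmul[OF C1_deriv_linear[OF f]])
  then have "((\<lambda>t. norm (g (0 + t) - g 0 - t *\<^sub>R f' x e) / norm t) \<longlongrightarrow> 0) (at 0)"
    unfolding has_vector_derivative_def has_derivative_at by blast
  moreover have "norm (g (0 + t) - g 0 - t *\<^sub>R f' x e) / norm t = norm ((g t - g 0) /\<^sub>R t - f' x e)"
    if "t \<noteq> 0" for t
  proof -
    have "(g t - g 0) /\<^sub>R t - f' x e = (g t - g 0 - t *\<^sub>R f' x e) /\<^sub>R t"
      using that by (simp add: scaleR_diff_right)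
    then show ?thesis by (simp add: divide_inverse mult.commute)
  qed
  ultimately have "((\<lambda>t. norm ((g t - g 0) /\<^sub>R t - f' x e)) \<longlongrightarrow> 0) (at 0)"
    by (simp cong: LIM_cong)
  then have "((\<lambda>t. (g t - g 0) /\<^sub>R t) \<longlongrightarrow> f' x e) (at 0)"
    by (subst (asm) tendsto_norm_zero_iff) (rule LIM_zero_cancel)
  moreover have "filterlim (\<lambda>n. inverse (real (Suc n))) (at 0) sequentially"
    using LIMSEQ_inverse_real_of_nat by (simp add: filterlim_at del: of_nat_Suc)
  ultimately have "(\<lambda>n. (g (inverse (real (Suc n))) - g 0) /\<^sub>R inverse (real (Suc n))) \<longlonglongrightarrow> f' x e"
    by (rule filterlim_compose)
  then show ?thesis
    by (simp add: diffquot_def g_def del: of_nat_Suc)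
qed

lemma diffquot_bounded:
  assumes f: "C1_deriv f f'" and K: "compact K"
  obtains B where "B \<ge> 0" "\<And>n x. x \<in> K \<Longrightarrow> norm (diffquot f e n x) \<le> B"
proof -
  define K' where "K' = (\<lambda>(x, t). x + t *\<^sub>R e) ` (K \<times> {0..1::real})"
  have "compact K'"
    unfolding K'_def split_def
    by (intro compact_continuous_image compact_Times K compact_Icc continuous_intros)
  then have "compact ((\<lambda>x. f' x e) ` K')"
    by (rule compact_continuous_image[OF continuous_on_subset[OF C1_deriv_continuous_deriv[OF f]], rotated]) simp
  then obtain B where B: "\<And>y. y \<in> K' \<Longrightarrow> norm (f' y e) \<le> B"
    by (meson compact_imp_bounded bounded_iff imageI)
  have "norm (diffquot f e n x) \<le> max 0 B" if x: "x \<in> K" for n x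
  proof -
    define h where "h = inverse (real (Suc n))"
    have h: "0 < h" "h \<le> 1" by (auto simp: h_def field_simps)
    have d: "((\<lambda>t. f (x + t *\<^sub>R e)) has_derivative (\<lambda>s. f' (x + t *\<^sub>R e) (s *\<^sub>R e))) (at t)" for t
    proof -
      have l: "((\<lambda>t. x + t *\<^sub>R e) has_derivative (\<lambda>t. t *\<^sub>R e)) (at t)"
        by (auto intro!: derivative_eq_intros)
      from diff_chain_at[OF l C1_deriv_has_derivative[OF f]] show ?thesis
        by (simp add: o_def)
    qed
    have "continuous_on {0..h} (\<lambda>t. f (x + t *\<^sub>R e))"
      using d by (intro continuous_at_imp_continuous_on ballI has_derivative_continuous)
    from mvt_general[OF h(1) this d] obtain t where t: "t \<in> {0<..<h}"
      and le: "norm (f (x + h *\<^sub>R e) - f x) \<le> norm (f' (x + t *\<^sub>R e) (h *\<^sub>R e))"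
      by auto
    have "x + t *\<^sub>R e \<in> K'" using x t h by (auto simp: K'_def intro!: image_eqI[where x="(x,t)"])
    then have "norm (f' (x + t *\<^sub>R e) e) \<le> B" by (rule B)
    then have "h * norm (f' (x + t *\<^sub>R e) e) \<le> h * B"
      using h by (intro mult_left_mono) auto
    moreover have "norm (f' (x + t *\<^sub>R e) (h *\<^sub>R e)) = h * norm (f' (x + t *\<^sub>R e) e)"
      using h by (simp add: linear_cmul[OF C1_deriv_linear[OF f]])
    ultimately have "norm (f (x + h *\<^sub>R e) - f x) \<le> h * B"
      using le by linarith
    then have "norm (f (x + h *\<^sub>R e) - f x) / h \<le> B"
      using h by (simp add: divide_le_eq mult.commute)
    moreover have "norm (diffquot f e n x) = norm (f (x + h *\<^sub>R e) - f x) / h"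
      by (simp add: diffquot_def h_def divide_inverse mult.commute del: of_nat_Suc)
    ultimately show ?thesis by simp
  qed
  then show ?thesis using that[of "max 0 B"] by auto
qed

lemma integrable_continuous_vanishing:
  fixes f :: "'a::euclidean_space \<Rightarrow> real"
  assumes f: "continuous_on UNIV f" and "\<And>x. R < norm x \<Longrightarrow> f x = 0"
  shows "integrable lborel f"
proof -
  have "integrable lborel (\<lambda>x. indicator (cball 0 R) x *\<^sub>R f x)"
    by (intro borel_integrable_compact compact_cball continuous_on_subset[OF f]) simp
  moreover have "(\<lambda>x. indicator (cball 0 R) x *\<^sub>R f x) = f"
    using assms(2) by (auto simp: indicator_def fun_eq_iff not_le)
  ultimately show ?thesis by simp
qed

lemma integral_tendsto_uniformly_supported:
  fixes f :: "'a::euclidean_space \<Rightarrow> real" and s :: "nat \<Rightarrow> 'a \<Rightarrow> real"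
  assumes s: "\<And>n. continuous_on UNIV (s n)"
    and supp: "\<And>n x. R < norm x \<Longrightarrow> s n x = 0"
    and bd: "\<And>n x. norm x \<le> R \<Longrightarrow> \<bar>s n x\<bar> \<le> B"
    and lim: "\<And>x. (\<lambda>n. s n x) \<longlonglongrightarrow> f x"
  shows "(\<lambda>n. integral\<^sup>L lborel (s n)) \<longlonglongrightarrow> integral\<^sup>L lborel f"
proof (rule integral_dominated_convergence)
  have sm: "s n \<in> borel_measurable lborel" for n
    using borel_measurable_continuous_onI[OF s] by simp
  then show "s n \<in> borel_measurable lborel" for n .
  show "f \<in> borel_measurable lborel"
    by (rule borel_measurable_LIMSEQ_real[OF lim sm])
  have "integrable lborel (\<lambda>x. indicator (cball 0 R) x *\<^sub>R B)"
    by (intro borel_integrable_compact compact_cball continuous_intros)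
  then show "integrable lborel (\<lambda>x::'a. indicator (cball 0 R) x * B)" by simp
  show "AE x in lborel. norm (s n x) \<le> indicator (cball 0 R) x * B" for n
    using supp bd by (auto simp: indicator_def)
qed (use lim in auto)

lemma lborel_integral_translate:
  fixes f :: "'a::euclidean_space \<Rightarrow> real"
  assumes "f \<in> borel_measurable borel"
  shows "(\<integral>x. f (x + c) \<partial>lborel) = (\<integral>x. f x \<partial>lborel)"
proof -
  have "(\<integral>x. f x \<partial>lborel) = (\<integral>x. f x \<partial>distr lborel borel ((+) c))"
    by (simp add: lborel_distr_plus)
  also have "\<dots> = (\<integral>x. f (c + x) \<partial>lborel)"
    by (rule integral_distr) (use assms in auto)
  finally show ?thesis by (simp add: add.commute)
qed

text \<open>The integral of a difference quotient vanishes by translation invariance of Lebesgue measure, so no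
iterated integration is needed.\<close>

lemma integral_deriv_eq_0:
  fixes f :: "'a::euclidean_space \<Rightarrow> real"
  assumes f: "C1_deriv f f'" and supp: "\<And>x. R < norm x \<Longrightarrow> f x = 0"
  shows "(\<integral>x. f' x e \<partial>lborel) = 0"
proof -
  have cf: "continuous_on UNIV f" by (rule C1_deriv_continuous[OF f])
  obtain B where B: "\<And>n x. x \<in> cball 0 (R + norm e) \<Longrightarrow> norm (diffquot f e n x) \<le> B"
    using diffquot_bounded[OF f compact_cball] by metis
  have "(\<lambda>n. integral\<^sup>L lborel (diffquot f e n)) \<longlonglongrightarrow> (\<integral>x. f' x e \<partial>lborel)"
  proof (rule integral_tendsto_uniformly_supported)
    show "continuous_on UNIV (diffquot f e n)" for n
      by (rule C1_deriv_continuous[OF C1_deriv_diffquot[OF f]])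
    show "\<bar>diffquot f e n x\<bar> \<le> B" if "norm x \<le> R + norm e" for n x
      using B that by simp
    show "diffquot f e n x = 0" if "R + norm e < norm x" for n x
    proof -
      have "norm (inverse (real (Suc n)) *\<^sub>R e) \<le> norm e"
        by (simp add: field_simps)
      moreover have "norm x \<le> norm (x + inverse (real (Suc n)) *\<^sub>R e) + norm (inverse (real (Suc n)) *\<^sub>R e)"
        by (metis norm_triangle_sub add_diff_cancel_left' norm_minus_commute add.commute)
      ultimately have "R < norm (x + inverse (real (Suc n)) *\<^sub>R e)" using that by linarith
      moreover have "R < norm x" using that by (smt (verit) norm_ge_zero)
      ultimately show ?thesis by (simp only: diffquot_def supp) simp
    qed
  qed (rule diffquot_tendsto[OF f])
  moreover have "integral\<^sup>L lborel (diffquot f e n) = 0" for n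
  proof -
    let ?c = "inverse (real (Suc n)) *\<^sub>R e"
    have m: "f \<in> borel_measurable borel" by (rule borel_measurable_continuous_onI[OF cf])
    have i: "integrable lborel f" by (rule integrable_continuous_vanishing[OF cf supp])
    have "continuous_on UNIV (\<lambda>x. f (x + ?c))"
      by (rule C1_deriv_continuous[OF C1_deriv_translate[OF f]])
    moreover have "f (x + ?c) = 0" if "R + norm ?c < norm x" for x
    proof (rule supp)
      have "norm x \<le> norm (x + ?c) + norm ?c"
        by (metis norm_triangle_sub add_diff_cancel_left' norm_minus_commute add.commute)
      then show "R < norm (x + ?c)" using that by linarith
    qed
    ultimately have i': "integrable lborel (\<lambda>x. f (x + ?c))"
      by (rule integrable_continuous_vanishing)
    show ?thesis
      unfolding diffquot_def using i i' lborel_integral_translate[OF m, of ?c] by simp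
  qed
  ultimately show ?thesis by (simp add: LIMSEQ_const_iff)
qed

section \<open>Symmetry of second derivatives\<close>

text \<open>Applying the mean value theorem twice, in either order, writes the same second difference of \<open>F\<close> as
\<open>h\<^sup>2\<close> times a value of \<open>D\<close> near \<open>Z\<close>.\<close>

lemma second_derivative_symmetric:
  fixes F :: "'a::euclidean_space \<Rightarrow> real"
  assumes F: "\<And>X. (F has_derivative F' X) (at X)"
    and D: "\<And>W. C1_deriv (\<lambda>X. F' X W) (\<lambda>X Y. D X Y W)"
  shows "D Z Y W = D Z W Y"
proof -
  have dline: "((\<lambda>t. f (P + t *\<^sub>R V)) has_real_derivative f' (P + t *\<^sub>R V) V) (at t)"
    if f: "\<And>X. (f has_derivative f' X) (at X)" for f :: "'a \<Rightarrow> real" and f' P V t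
  proof -
    have l: "((\<lambda>t. P + t *\<^sub>R V) has_derivative (\<lambda>t. t *\<^sub>R V)) (at t)"
      by (auto intro!: derivative_eq_intros)
    have "linear (f' (P + t *\<^sub>R V))" using f has_derivative_linear by blast
    then show ?thesis
      using diff_chain_at[OF l f]
      by (simp add: o_def has_field_derivative_def linear_cmul mult_commute_abs)
  qed
  have mvt: "\<exists>s t. 0 < s \<and> s < h \<and> 0 < t \<and> t < h \<and>
      F (Z + h *\<^sub>R V + h *\<^sub>R U) - F (Z + h *\<^sub>R V) - F (Z + h *\<^sub>R U) + F Z
        = h * (h * D (Z + s *\<^sub>R V + t *\<^sub>R U) U V)" if "0 < h" for h V U
  proof -
    let ?\<phi> = "\<lambda>s. F (Z + h *\<^sub>R U + s *\<^sub>R V) - F (Z + s *\<^sub>R V)"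
    have "(?\<phi> has_real_derivative F' (Z + h *\<^sub>R U + s *\<^sub>R V) V - F' (Z + s *\<^sub>R V) V) (at s)" for s
      by (intro DERIV_diff dline F)
    from MVT2[OF \<open>0 < h\<close> this] obtain s where s: "0 < s" "s < h"
      and eq: "?\<phi> h - ?\<phi> 0 = h * (F' (Z + h *\<^sub>R U + s *\<^sub>R V) V - F' (Z + s *\<^sub>R V) V)"
      by auto
    let ?\<psi> = "\<lambda>t. F' (Z + s *\<^sub>R V + t *\<^sub>R U) V"
    have "(?\<psi> has_real_derivative D (Z + s *\<^sub>R V + t *\<^sub>R U) U V) (at t)" for t
      by (rule dline[OF C1_deriv_has_derivative[OF D]])
    from MVT2[OF \<open>0 < h\<close> this] obtain t where t: "0 < t" "t < h"
      and eq': "?\<psi> h - ?\<psi> 0 = h * D (Z + s *\<^sub>R V + t *\<^sub>R U) U V"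
      by auto
    have "F (Z + h *\<^sub>R V + h *\<^sub>R U) - F (Z + h *\<^sub>R V) - F (Z + h *\<^sub>R U) + F Z
        = h * (h * D (Z + s *\<^sub>R V + t *\<^sub>R U) U V)"
      using eq eq' by (simp add: algebra_simps)
    with s t show ?thesis by blast
  qed
  define h where "h n = inverse (real (Suc n))" for n
  have h: "0 < h n" for n by (simp add: h_def)
  have h0: "h \<longlonglongrightarrow> 0"
    unfolding h_def by (rule LIMSEQ_inverse_real_of_nat)
  have lim: "(\<lambda>n. D (Z + s n *\<^sub>R V + t n *\<^sub>R U) U V) \<longlonglongrightarrow> D Z U V"
    if st: "\<And>n. 0 < s n \<and> s n < h n \<and> 0 < t n \<and> t n < h n" for s t V U
  proof -
    have "s \<longlonglongrightarrow> 0" "t \<longlonglongrightarrow> 0"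
      using st by (auto intro!: tendsto_sandwich[OF _ _ tendsto_const h0] always_eventually less_imp_le)
    then have "(\<lambda>n. Z + s n *\<^sub>R V + t n *\<^sub>R U) \<longlonglongrightarrow> Z + 0 *\<^sub>R V + 0 *\<^sub>R U"
      by (intro tendsto_intros)
    then have "(\<lambda>n. Z + s n *\<^sub>R V + t n *\<^sub>R U) \<longlonglongrightarrow> Z" by simp
    moreover have "isCont (\<lambda>X. D X U V) Z"
      using C1_deriv_continuous_deriv[OF D] by (simp add: continuous_on_eq_continuous_at)
    ultimately show ?thesis by (rule isCont_tendsto_compose[rotated])
  qed
  have ex: "\<exists>s t. (\<forall>n. 0 < s n \<and> s n < h n \<and> 0 < t n \<and> t n < h n) \<and> (\<forall>n.
      F (Z + h n *\<^sub>R V + h n *\<^sub>R U) - F (Z + h n *\<^sub>R V) - F (Z + h n *\<^sub>R U) + F Z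
        = h n * (h n * D (Z + s n *\<^sub>R V + t n *\<^sub>R U) U V))" for V U
  proof -
    from choice[OF allI, OF mvt[OF h]] obtain s where
      "\<forall>n. \<exists>t. 0 < s n \<and> s n < h n \<and> 0 < t \<and> t < h n \<and>
      F (Z + h n *\<^sub>R V + h n *\<^sub>R U) - F (Z + h n *\<^sub>R V) - F (Z + h n *\<^sub>R U) + F Z
        = h n * (h n * D (Z + s n *\<^sub>R V + t *\<^sub>R U) U V)" ..
    from choice[OF this] show ?thesis by blast
  qed
  obtain s t where st: "\<And>n. 0 < s n \<and> s n < h n \<and> 0 < t n \<and> t n < h n"
    and est: "\<And>n. F (Z + h n *\<^sub>R Y + h n *\<^sub>R W) - F (Z + h n *\<^sub>R Y) - F (Z + h n *\<^sub>R W) + F Z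
        = h n * (h n * D (Z + s n *\<^sub>R Y + t n *\<^sub>R W) W Y)"
    using ex[of Y W] by auto
  obtain s' t' where st': "\<And>n. 0 < s' n \<and> s' n < h n \<and> 0 < t' n \<and> t' n < h n"
    and est': "\<And>n. F (Z + h n *\<^sub>R W + h n *\<^sub>R Y) - F (Z + h n *\<^sub>R W) - F (Z + h n *\<^sub>R Y) + F Z
        = h n * (h n * D (Z + s' n *\<^sub>R W + t' n *\<^sub>R Y) Y W)"
    using ex[of W Y] by auto
  have "D (Z + s n *\<^sub>R Y + t n *\<^sub>R W) W Y = D (Z + s' n *\<^sub>R W + t' n *\<^sub>R Y) Y W" for n
  proof -
    have "F (Z + h n *\<^sub>R W + h n *\<^sub>R Y) = F (Z + h n *\<^sub>R Y + h n *\<^sub>R W)"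
      by (simp add: ac_simps)
    then have "h n * (h n * D (Z + s n *\<^sub>R Y + t n *\<^sub>R W) W Y)
        = h n * (h n * D (Z + s' n *\<^sub>R W + t' n *\<^sub>R Y) Y W)"
      using est[of n] est'[of n] by linarith
    then show ?thesis using h[of n] by simp
  qed
  with lim[OF st, of Y W] lim[OF st', of W Y] show ?thesis
    using LIMSEQ_unique by fastforce
qed

section \<open>Divergence-free fields and the differentiated equation\<close>

text \<open>The tensor product of \<open>w\<close> and \<open>g\<close>, the matrix of rank at most one with entries \<open>w\<^sub>i g\<^sub>\<alpha>\<close>.\<close>

definition outer :: "real^'n \<Rightarrow> real^'m \<Rightarrow> real^'m^'n" where
  "outer w g = (\<chi> i \<alpha>. w $ i * g $ \<alpha>)"

lemma outer_nth [simp]: "outer w g $ i $ \<alpha> = w $ i * g $ \<alpha>"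
  by (simp add: outer_def)

lemma norm_outer: "norm (outer w g) = norm w * norm g"
proof -
  have "outer w g \<bullet> outer w g = (w \<bullet> w) * (g \<bullet> g)"
    by (simp add: inner_vec_def sum_product) (simp add: mult_ac)
  then have "(norm (outer w g))\<^sup>2 = (norm w * norm g)\<^sup>2"
    by (simp only: power2_norm_eq_inner power_mult_distrib)
  then show ?thesis by (simp add: power2_eq_iff_nonneg)
qed

lemma bounded_bilinear_outer: "bounded_bilinear (outer :: real^'n \<Rightarrow> real^'m \<Rightarrow> _)"
proof
  show "\<exists>K. \<forall>a b. norm (outer (a::real^'n) (b::real^'m)) \<le> norm a * norm b * K"
    by (rule exI[of _ 1]) (simp add: norm_outer)
qed (simp_all add: vec_eq_iff algebra_simps)

lemma outer_zero_right [simp]: "outer w 0 = 0"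
  by (simp add: vec_eq_iff)

lemma outer_scaleR_right: "outer w (c *\<^sub>R g) = c *\<^sub>R outer w g"
  by (simp add: vec_eq_iff)

lemma outer_mult_vec: "outer w g *v v = (g \<bullet> v) *\<^sub>R w"
  by (simp add: vec_eq_iff matrix_vector_mult_def inner_vec_def sum_distrib_left sum_distrib_right mult_ac)

lemma matrix_nth_eq: "(P::real^'m^'n) $ i $ \<alpha> = (P *v axis \<alpha> 1) $ i"
  by (simp add: matrix_vector_mult_basis column_def)

text \<open>Here \<open>P\<close> is the gradient matrix of the test function \<open>\<phi>\<close>.  That \<open>P\<close> vanishes outside the ball follows from the
corresponding assumption on \<open>\<phi>\<close>, but it is immediate in each use.\<close>

lemma integral_divergence_free:
  fixes V :: "real^'m \<Rightarrow> real^'m^'n" and \<phi> :: "real^'m \<Rightarrow> real^'n"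
  assumes V: "C1_deriv V V'" and div: "\<And>x i. (\<Sum>\<alpha>\<in>UNIV. V' x (axis \<alpha> 1) $ i $ \<alpha>) = 0"
    and \<phi>: "C1_deriv \<phi> (\<lambda>x v. P x *v v)"
    and supp: "\<And>x. R < norm x \<Longrightarrow> \<phi> x = 0" and suppP: "\<And>x. R < norm x \<Longrightarrow> P x = 0"
  shows "(\<integral>x. V x \<bullet> P x \<partial>lborel) = 0"
proof -
  define d where "d i \<alpha> x = V x $ i $ \<alpha> * P x $ i $ \<alpha> + V' x (axis \<alpha> 1) $ i $ \<alpha> * \<phi> x $ i" for i \<alpha> x
  have c: "C1_deriv (\<lambda>x. V x $ i $ \<alpha> * \<phi> x $ i)
      (\<lambda>x v. V x $ i $ \<alpha> * (P x *v v) $ i + V' x v $ i $ \<alpha> * \<phi> x $ i)" for i \<alpha>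
    by (intro C1_deriv_bounded_bilinear[OF bounded_bilinear_mult]
        C1_deriv_bounded_linear[OF bounded_linear_vec_nth] V \<phi>)
  have I0: "integral\<^sup>L lborel (d i \<alpha>) = 0" for i \<alpha>
    using integral_deriv_eq_0[OF c, where R=R and e="axis \<alpha> 1"] supp by (simp add: d_def[abs_def] matrix_nth_eq)
  have cP: "continuous_on UNIV (\<lambda>x. P x $ i $ \<alpha>)" for i \<alpha>
    unfolding matrix_nth_eq[of "P _"] by (intro continuous_intros C1_deriv_continuous_deriv[OF \<phi>])
  have "continuous_on UNIV (d i \<alpha>)" for i \<alpha>
    unfolding d_def
    by (intro continuous_on_add continuous_on_mult cP continuous_on_component
        C1_deriv_continuous_deriv[OF V] C1_deriv_continuous[OF V] C1_deriv_continuous[OF \<phi>])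
  then have int: "integrable lborel (d i \<alpha>)" for i \<alpha>
    by (rule integrable_continuous_vanishing[where R=R]) (use supp suppP in \<open>auto simp: d_def\<close>)
  have "V x \<bullet> P x = (\<Sum>i\<in>UNIV. \<Sum>\<alpha>\<in>UNIV. d i \<alpha> x)" for x
  proof -
    have "(\<Sum>i\<in>UNIV. \<Sum>\<alpha>\<in>UNIV. V' x (axis \<alpha> 1) $ i $ \<alpha> * \<phi> x $ i)
        = (\<Sum>i\<in>UNIV. (\<Sum>\<alpha>\<in>UNIV. V' x (axis \<alpha> 1) $ i $ \<alpha>) * \<phi> x $ i)"
      by (simp add: sum_distrib_right)
    also have "\<dots> = 0" by (simp add: div)
    finally show ?thesis by (simp add: d_def sum.distrib inner_vec_def)
  qed
  then have "(\<integral>x. V x \<bullet> P x \<partial>lborel) = (\<Sum>i\<in>UNIV. \<Sum>\<alpha>\<in>UNIV. integral\<^sup>L lborel (d i \<alpha>))"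
    using int by simp
  then show ?thesis by (simp add: I0)
qed

text \<open>The test function is \<open>\<zeta> w\<close>, where \<open>g\<close> is the gradient of \<open>\<zeta>\<close>.\<close>

lemma weak_equation:
  fixes V :: "real^'m \<Rightarrow> real^'m^'n" and w :: "real^'m \<Rightarrow> real^'n"
  assumes V: "C1_deriv V V'" and div: "\<And>x i. (\<Sum>\<alpha>\<in>UNIV. V' x (axis \<alpha> 1) $ i $ \<alpha>) = 0"
    and w: "C1_deriv w (\<lambda>x v. P x *v v)"
    and \<zeta>: "C1_deriv \<zeta> (\<lambda>x v. g x \<bullet> v)"
    and supp: "\<And>x. R < norm x \<Longrightarrow> \<zeta> x = 0" and suppg: "\<And>x. R < norm x \<Longrightarrow> g x = 0"
  shows "(\<integral>x. V x \<bullet> (\<zeta> x *\<^sub>R P x + outer (w x) (g x)) \<partial>lborel) = 0"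
proof (rule integral_divergence_free[OF V div])
  have "C1_deriv (\<lambda>x. \<zeta> x *\<^sub>R w x) (\<lambda>x v. \<zeta> x *\<^sub>R (P x *v v) + (g x \<bullet> v) *\<^sub>R w x)"
    by (rule C1_deriv_bounded_bilinear[OF bounded_bilinear_scaleR \<zeta> w])
  then show "C1_deriv (\<lambda>x. \<zeta> x *\<^sub>R w x) (\<lambda>x v. (\<zeta> x *\<^sub>R P x + outer (w x) (g x)) *v v)"
    by (simp add: matrix_vector_mult_add_rdistrib outer_mult_vec scaleR_matrix_vector_assoc)
qed (use supp suppg in auto)

text \<open>Formally this is the weak equation for \<open>\<partial>\<^sub>e V\<close> tested with \<open>\<zeta> \<partial>\<^sub>e u\<close>.  The difference quotients of \<open>V\<close> are
divergence-free \<open>C\<^sup>1\<close> fields, and those of \<open>u\<close> are admissible test functions.  In the limit \<open>\<partial>\<^sub>e P\<close> takes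
the place of the gradient of \<open>\<partial>\<^sub>e u\<close>.\<close>

lemma differentiated_weak_equation:
  fixes V :: "real^'m \<Rightarrow> real^'m^'n" and u :: "real^'m \<Rightarrow> real^'n"
  assumes V: "C1_deriv V V'" and div: "\<And>x i. (\<Sum>\<alpha>\<in>UNIV. V' x (axis \<alpha> 1) $ i $ \<alpha>) = 0"
    and u: "C1_deriv u (\<lambda>x v. P x *v v)" and P: "C1_deriv P P'"
    and \<zeta>: "C1_deriv \<zeta> (\<lambda>x v. g x \<bullet> v)" and g: "continuous_on UNIV g"
    and supp: "\<And>x. R < norm x \<Longrightarrow> \<zeta> x = 0" and suppg: "\<And>x. R < norm x \<Longrightarrow> g x = 0"
  shows "(\<integral>x. V' x e \<bullet> (\<zeta> x *\<^sub>R P' x e + outer (P x *v e) (g x)) \<partial>lborel) = 0"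
proof -
  define s where "s n x = diffquot V e n x \<bullet>
    (\<zeta> x *\<^sub>R diffquot P e n x + outer (diffquot u e n x) (g x))" for n x
  have dV: "C1_deriv (diffquot V e n) (\<lambda>x v. diffquot (\<lambda>y. V' y v) e n x)" for n
    by (rule C1_deriv_diffquot[OF V])
  have du: "C1_deriv (diffquot u e n) (\<lambda>x v. diffquot P e n x *v v)" for n
  proof -
    have "diffquot (\<lambda>y. P y *v v) e n x = diffquot P e n x *v v" for x v
      by (simp add: diffquot_def matrix_vector_mult_diff_rdistrib flip: scaleR_matrix_vector_assoc)
    then show ?thesis using C1_deriv_diffquot[OF u, of e n] by simp
  qed
  have ddiv: "(\<Sum>\<alpha>\<in>UNIV. diffquot (\<lambda>y. V' y (axis \<alpha> 1)) e n x $ i $ \<alpha>) = 0" for x i n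
    unfolding diffquot_def by (simp add: div sum_subtractf flip: sum_distrib_left)
  have "integral\<^sup>L lborel (s n) = 0" for n
    unfolding s_def using weak_equation[OF dV ddiv du \<zeta> supp suppg] .
  moreover have "(\<lambda>n. integral\<^sup>L lborel (s n)) \<longlonglongrightarrow>
      (\<integral>x. V' x e \<bullet> (\<zeta> x *\<^sub>R P' x e + outer (P x *v e) (g x)) \<partial>lborel)"
  proof -
    have cz: "continuous_on UNIV \<zeta>" by (rule C1_deriv_continuous[OF \<zeta>])
    have cb: "compact (cball (0::real^'m) R)" by simp
    obtain B1 where B1: "B1 \<ge> 0" "\<And>n x. x \<in> cball 0 R \<Longrightarrow> norm (diffquot V e n x) \<le> B1"
      using diffquot_bounded[OF V cb, where e=e] by blast
    obtain B2 where B2: "B2 \<ge> 0" "\<And>n x. x \<in> cball 0 R \<Longrightarrow> norm (diffquot P e n x) \<le> B2"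
      using diffquot_bounded[OF P cb, where e=e] by blast
    obtain B3 where B3: "B3 \<ge> 0" "\<And>n x. x \<in> cball 0 R \<Longrightarrow> norm (diffquot u e n x) \<le> B3"
      using diffquot_bounded[OF u cb, where e=e] by blast
    have "compact (\<zeta> ` cball 0 R)" "compact (g ` cball 0 R)"
      using cz g by (auto intro!: compact_continuous_image continuous_on_subset[of UNIV])
    then obtain B4 B5 where B4: "\<And>x. x \<in> cball 0 R \<Longrightarrow> \<bar>\<zeta> x\<bar> \<le> B4"
      and B5: "\<And>x. x \<in> cball 0 R \<Longrightarrow> norm (g x) \<le> B5"
      by (metis compact_imp_bounded bounded_iff imageI real_norm_def)
    show ?thesis
    proof (rule integral_tendsto_uniformly_supported)
      show "continuous_on UNIV (s n)" for n
        unfolding s_def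
        by (intro continuous_intros cz g bounded_bilinear.continuous_on[OF bounded_bilinear_outer]
            C1_deriv_continuous[OF dV] C1_deriv_continuous[OF du]
            C1_deriv_continuous[OF C1_deriv_diffquot[OF P]])
      show "s n x = 0" if "R < norm x" for n x
        using supp[OF that] suppg[OF that] by (simp add: s_def)
      show "\<bar>s n x\<bar> \<le> B1 * (B4 * B2 + B3 * B5)" if "norm x \<le> R" for n x
      proof -
        have x: "x \<in> cball 0 R" using that by simp
        have "\<bar>s n x\<bar> \<le> norm (diffquot V e n x) *
            norm (\<zeta> x *\<^sub>R diffquot P e n x + outer (diffquot u e n x) (g x))"
          unfolding s_def by (rule Cauchy_Schwarz_ineq2)
        also have "\<dots> \<le> B1 * (B4 * B2 + B3 * B5)"
        proof (intro mult_mono B1 x norm_ge_zero order.trans[OF norm_triangle_ineq] add_mono)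
          show "norm (\<zeta> x *\<^sub>R diffquot P e n x) \<le> B4 * B2"
            using B4[OF x] B2(2)[OF x, of n] by (auto intro!: mult_mono)
          show "norm (outer (diffquot u e n x) (g x)) \<le> B3 * B5"
            using B5[OF x] B3(2)[OF x, of n] B3(1) by (auto simp: norm_outer intro!: mult_mono)
        qed
        finally show ?thesis .
      qed
      show "(\<lambda>n. s n x) \<longlonglongrightarrow> V' x e \<bullet> (\<zeta> x *\<^sub>R P' x e + outer (P x *v e) (g x))" for x
        unfolding s_def
        by (intro tendsto_intros bounded_bilinear.tendsto[OF bounded_bilinear_outer]
            diffquot_tendsto V P u)
    qed
  qed
  ultimately show ?thesis by (simp add: LIMSEQ_const_iff)
qed

section \<open>Cutoff functions\<close>

text \<open>The square of the positive part, a \<open>C\<^sup>1\<close> building block for cutoff functions.\<close>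

definition pos_sq :: "real \<Rightarrow> real" where
  "pos_sq t = (max 0 t)\<^sup>2"

lemma C1_deriv_pos_sq: "C1_deriv pos_sq (\<lambda>t s. 2 * max 0 t * s)"
proof (rule C1_derivI)
  show "(pos_sq has_derivative (\<lambda>s. 2 * max 0 t * s)) (at t)" for t
  proof (cases "t = 0")
    case True
    have "((\<lambda>h::real. norm (pos_sq (0 + h) - pos_sq 0 - 2 * max 0 0 * h) / norm h) \<longlongrightarrow> 0) (at 0)"
    proof (rule tendsto_sandwich[OF _ _ tendsto_const])
      show "((\<lambda>h::real. \<bar>h\<bar>) \<longlongrightarrow> 0) (at 0)" by (intro tendsto_eq_intros) auto
    qed (auto simp: pos_sq_def power2_eq_square max_def intro!: always_eventually)
    then show ?thesis
      using True by (simp add: has_derivative_at bounded_linear_zero)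
  next
    case False
    then have "t < 0 \<or> 0 < t" by auto
    then show ?thesis
    proof
      assume "t < 0"
      have "((\<lambda>t. 0) has_derivative (\<lambda>s. 2 * max 0 t * s)) (at t)"
        using \<open>t < 0\<close> by (auto intro!: derivative_eq_intros)
      then show ?thesis
        by (rule has_derivative_transform_within_open[of _ _ _ _ "{..<0}"])
          (use \<open>t < 0\<close> in \<open>auto simp: pos_sq_def\<close>)
    next
      assume "0 < t"
      have "((\<lambda>t. t\<^sup>2) has_derivative (\<lambda>s. 2 * max 0 t * s)) (at t)"
        using \<open>0 < t\<close> by (auto intro!: derivative_eq_intros)
      then show ?thesis
        by (rule has_derivative_transform_within_open[of _ _ _ _ "{0<..}"])
          (use \<open>0 < t\<close> in \<open>auto simp: pos_sq_def\<close>)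
    qed
  qed
qed (intro continuous_intros)

text \<open>With \<open>p = pos_sq\<close>, the cutoff function is \<open>\<eta> x = p (1 - p (|x|\<^sup>2/R\<^sup>2 - 1))\<close>: it equals \<open>1\<close> where \<open>|x| \<le> R\<close>
and vanishes already where \<open>|x|\<^sup>2 \<ge> 2 R\<^sup>2\<close>.\<close>

lemma cutoff_exists:
  assumes "R > 0"
  obtains \<eta> :: "'a::euclidean_space \<Rightarrow> real" and g :: "'a \<Rightarrow> 'a"
  where "C1_deriv \<eta> (\<lambda>x v. g x \<bullet> v)" "continuous_on UNIV g"
    "\<And>x. 0 \<le> \<eta> x" "\<And>x. \<eta> x \<le> 1" "\<And>x. norm x \<le> R \<Longrightarrow> \<eta> x = 1"
    "\<And>x. norm x \<le> R \<Longrightarrow> g x = 0"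
    "\<And>x. 2 * R < norm x \<Longrightarrow> \<eta> x = 0" "\<And>x. 2 * R < norm x \<Longrightarrow> g x = 0"
    "\<And>x. norm (g x) \<le> 16 / R"
proof -
  define q where "q x = inverse (R\<^sup>2) * (x \<bullet> x) - 1" for x :: 'a
  define r where "r x = 1 - pos_sq (q x)" for x
  define \<eta> where "\<eta> x = pos_sq (r x)" for x
  define c where "c x = - 8 * max 0 (r x) * max 0 (q x) / R\<^sup>2" for x
  have q: "C1_deriv q (\<lambda>x v. inverse (R\<^sup>2) * (2 * (x \<bullet> v)))"
    unfolding q_def
    by (intro C1_derivI) (auto intro!: derivative_eq_intros continuous_intros simp: inner_commute fun_eq_iff)
  have pq: "C1_deriv (\<lambda>x. pos_sq (q x)) (\<lambda>x v. 2 * max 0 (q x) * (inverse (R\<^sup>2) * (2 * (x \<bullet> v))))"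
    by (rule C1_deriv_compose[OF q C1_deriv_pos_sq])
  have one: "C1_deriv (\<lambda>x::'a. 1::real) (\<lambda>x v. 0)"
    by (intro C1_derivI) auto
  have r: "C1_deriv r (\<lambda>x v. 0 - 2 * max 0 (q x) * (inverse (R\<^sup>2) * (2 * (x \<bullet> v))))"
    unfolding r_def by (rule C1_deriv_diff[OF one pq])
  have \<eta>: "C1_deriv \<eta> (\<lambda>x v. (c x *\<^sub>R x) \<bullet> v)"
    using C1_deriv_compose[OF r C1_deriv_pos_sq]
    by (simp add: \<eta>_def[abs_def] c_def divide_inverse mult_ac)
  have cont: "continuous_on UNIV (\<lambda>x. c x *\<^sub>R x)"
    unfolding c_def
    by (intro continuous_intros C1_deriv_continuous[OF q] C1_deriv_continuous[OF r]) (use assms in auto)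
  have q_le: "q x \<le> 0" if "norm x \<le> R" for x
  proof -
    have "(norm x)\<^sup>2 \<le> R\<^sup>2" using that by (intro power_mono) auto
    then show ?thesis using assms by (simp add: q_def power2_norm_eq_inner field_simps)
  qed
  have q_ge: "1 \<le> q x" if "2 * R < norm x" for x
  proof -
    have "(2 * R)\<^sup>2 \<le> (norm x)\<^sup>2" using that assms by (intro power_mono) auto
    then have "4 * R\<^sup>2 \<le> x \<bullet> x" by (simp add: power2_norm_eq_inner power_mult_distrib)
    moreover have "0 < R\<^sup>2" using assms by simp
    ultimately have "2 * R\<^sup>2 \<le> x \<bullet> x" by linarith
    then show ?thesis using assms by (simp add: q_def field_simps)
  qed
  have r_le: "r x \<le> 1" for x by (simp add: r_def pos_sq_def)
  have r_neg: "r x \<le> 0" if "1 \<le> q x" for x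
  proof -
    have "1 \<le> (q x)\<^sup>2" using that by (simp add: one_le_power)
    then show ?thesis using that by (simp add: r_def pos_sq_def max_def)
  qed
  have nb: "norm (c x *\<^sub>R x) \<le> 16 / R" for x
  proof (cases "norm x \<le> 2 * R \<and> q x \<le> 1")
    case True
    have "\<bar>c x\<bar> = 8 * (max 0 (r x) * max 0 (q x)) / R\<^sup>2"
      by (simp add: c_def abs_mult)
    also have "\<dots> \<le> 8 * (1 * 1) / R\<^sup>2"
      using True r_le[of x] by (intro divide_right_mono mult_left_mono mult_mono) auto
    finally have "\<bar>c x\<bar> * norm x \<le> 8 / R\<^sup>2 * (2 * R)"
      using True by (intro mult_mono) auto
    then show ?thesis using assms by (simp add: power2_eq_square)
  next
    case False
    then have "1 \<le> q x" using q_ge[of x] by linarith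
    then have "c x = 0" using r_neg[of x] by (simp add: c_def max_def)
    then show ?thesis using assms by simp
  qed
  show ?thesis
  proof (rule that[OF \<eta> cont])
    show "\<eta> x \<le> 1" for x
      using r_le[of x] by (simp add: \<eta>_def pos_sq_def power_le_one)
    show "norm x \<le> R \<Longrightarrow> \<eta> x = 1" "norm x \<le> R \<Longrightarrow> c x *\<^sub>R x = 0" for x
      using q_le[of x] by (simp_all add: \<eta>_def r_def pos_sq_def c_def)
    show "2 * R < norm x \<Longrightarrow> \<eta> x = 0" "2 * R < norm x \<Longrightarrow> c x *\<^sub>R x = 0" for x
      using r_neg[OF q_ge[of x]] by (simp_all add: \<eta>_def pos_sq_def c_def)
  qed (use nb in \<open>simp_all add: \<eta>_def pos_sq_def\<close>)
qed

section \<open>Auxiliary estimates\<close>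

lemma norm_matrix_vector_mult_le: "norm (P *v v) \<le> norm P * norm v"
  for P :: "real^'m^'n"
proof -
  have "(P *v v) \<bullet> (P *v v) = (\<Sum>i\<in>UNIV. (P $ i \<bullet> v)\<^sup>2)"
    by (simp add: inner_vec_def matrix_vector_mul_component power2_eq_square)
  also have "\<dots> \<le> (\<Sum>i\<in>UNIV. (P $ i \<bullet> P $ i) * (v \<bullet> v))"
    by (intro sum_mono Cauchy_Schwarz_ineq)
  also have "\<dots> = (P \<bullet> P) * (v \<bullet> v)"
    by (simp add: inner_vec_def[of P] sum_distrib_right)
  finally have "(norm (P *v v))\<^sup>2 \<le> (norm P * norm v)\<^sup>2"
    by (simp only: power2_norm_eq_inner power_mult_distrib)
  then show ?thesis by (rule power2_le_imp_le) simp
qed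

lemma integrable_indicator_cball:
  fixes f :: "'a::euclidean_space \<Rightarrow> real"
  assumes "continuous_on UNIV f"
  shows "integrable lborel (\<lambda>x. indicator (cball 0 R) x * f x)"
  using borel_integrable_compact[OF compact_cball continuous_on_subset[OF assms subset_UNIV]] by simp

lemma eq_0_if_integral_cball_eq_0:
  fixes f :: "'a::euclidean_space \<Rightarrow> real"
  assumes f: "continuous_on UNIV f" and nonneg: "\<And>x. 0 \<le> f x"
    and int: "(\<integral>x. indicator (cball 0 R) x * f x \<partial>lborel) = 0" and y: "norm y < R"
  shows "f y = 0"
proof (rule ccontr)
  assume "f y \<noteq> 0"
  then have fy: "f y > 0" using nonneg[of y] by simp
  define U where "U = ball 0 R \<inter> {x. 0 < f x}"
  have "open U"
    unfolding U_def by (intro open_Int open_ball open_Collect_less f continuous_intros)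
  moreover have "U \<noteq> {}" using fy y by (auto simp: U_def)
  ultimately have "\<not> negligible U" by (rule open_not_negligible)
  have "AE x in lborel. indicator (cball 0 R) x * f x = 0"
    using integral_nonneg_eq_0_iff_AE[OF integrable_indicator_cball[OF f, of R]] int nonneg by simp
  then have "AE x in lborel. x \<notin> U"
    by (rule AE_mp) (auto simp: U_def intro!: AE_I2)
  then have "U \<in> null_sets lborel"
    using \<open>open U\<close> by (subst (asm) AE_iff_null_sets[symmetric]) auto
  then have "negligible U"
    by (simp add: negligible_iff_null_sets null_sets_completionI)
  with \<open>\<not> negligible U\<close> show False ..
qed

lemma integral_indicator_cball:
  fixes a :: "'a::euclidean_space"
  assumes "0 \<le> R"
  shows "(\<integral>x. indicator (cball (0::'a) R) x \<partial>lborel) = R ^ DIM('a) * measure lborel (ball (0::'a) 1)"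
  using content_ball_conv_unit_ball[OF assms, of "0::'a"]
  by (simp add: content_cball_conv_ball)

text \<open>In the application \<open>I R\<close> is the integral of \<open>Q\<close> over \<open>B\<^sub>R\<close> and \<open>E\<close> that of \<open>\<eta>\<^sup>2 Q\<close>.  The case \<open>\<delta> = 2\<close> absorbs
half of \<open>E\<close> into the left-hand side and bounds \<open>I\<close>.  Along \<open>R = 2^n\<close> the increments of \<open>I\<close> then tend to \<open>0\<close>,
which leaves \<open>lim I \<le> \<delta> C\<close>.\<close>

lemma doubling_absorption:
  fixes I :: "real \<Rightarrow> real"
  assumes nonneg: "\<And>R. 0 \<le> I R" and mono: "\<And>R S. R \<le> S \<Longrightarrow> I R \<le> I S"
    and C: "0 \<le> C"
    and ex: "\<And>R. 1 \<le> R \<Longrightarrow> \<exists>E. I R \<le> E \<and> E \<le> I (2 * R) \<and> (\<forall>\<delta>>0. E \<le> (E - I R) / \<delta> + \<delta> * C)"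
  shows "I R = 0"
proof -
  have bd: "I R \<le> 4 * C" if R: "1 \<le> R" for R
  proof -
    obtain E where E: "I R \<le> E" "\<And>\<delta>. \<delta> > 0 \<Longrightarrow> E \<le> (E - I R) / \<delta> + \<delta> * C"
      using ex[OF R] by blast
    from E(1) E(2)[of 2] show ?thesis using nonneg[of R] by (simp add: field_simps)
  qed
  define X where "X n = I (2 ^ n)" for n
  have "incseq X" unfolding X_def by (intro monoI mono power_increasing) auto
  moreover have "X n \<le> 4 * C" for n unfolding X_def by (intro bd) simp
  ultimately obtain L where L: "X \<longlonglongrightarrow> L" and le: "\<And>n. X n \<le> L"
    using incseq_convergent[of X "4 * C"] by metis
  have est: "L \<le> \<delta> * C" if "\<delta> > 0" for \<delta>
  proof -
    have "X n \<le> (X (Suc n) - X n) / \<delta> + \<delta> * C" for n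
    proof -
      have "(1::real) \<le> 2 ^ n" by simp
      from ex[OF this] obtain E where E: "X n \<le> E" "E \<le> X (Suc n)" "E \<le> (E - X n) / \<delta> + \<delta> * C"
        using \<open>\<delta> > 0\<close> by (auto simp: X_def)
      have "(E - X n) / \<delta> \<le> (X (Suc n) - X n) / \<delta>"
        using E \<open>\<delta> > 0\<close> by (intro divide_right_mono) auto
      then show ?thesis using E by linarith
    qed
    moreover have "(\<lambda>n. (X (Suc n) - X n) / \<delta> + \<delta> * C) \<longlonglongrightarrow> (L - L) / \<delta> + \<delta> * C"
      using \<open>\<delta> > 0\<close> by (intro tendsto_intros L LIMSEQ_Suc) auto
    ultimately have "L \<le> (L - L) / \<delta> + \<delta> * C"
      by (intro LIMSEQ_le[OF L]) auto
    then show ?thesis by simp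
  qed
  have "L \<le> 0"
  proof (rule field_le_epsilon)
    fix \<epsilon> :: real assume "0 < \<epsilon>"
    then have "L \<le> \<epsilon> / (C + 1) * C" using C by (intro est) simp
    also have "\<dots> \<le> \<epsilon>" using C \<open>0 < \<epsilon>\<close> by (simp add: field_simps)
    finally show "L \<le> 0 + \<epsilon>" by simp
  qed
  obtain n where "R \<le> 2 ^ n" using real_arch_pow[of 2 R] by (auto intro: less_imp_le)
  then have "I R \<le> X n" unfolding X_def by (rule mono)
  then show ?thesis using le[of n] \<open>L \<le> 0\<close> nonneg[of R] by simp
qed

section \<open>Elliptic systems in the plane\<close>

text \<open>The structure used in both estimates: \<open>G = \<nabla>F\<close> with derivative \<open>A\<close>, so that \<open>A X Y \<bullet> W = D\<^sup>2F(X)(Y, W)\<close>, and a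
solution \<open>u\<close> with gradient matrix \<open>P\<close>, whose derivative in direction \<open>v\<close> at \<open>x\<close> is \<open>H x v\<close>.  The last assumption
is the system \<open>div [G(P)] = 0\<close>, written out by the chain rule.\<close>

locale elliptic_system =
  fixes G :: "real^2^'n::finite \<Rightarrow> real^2^'n" and A :: "real^2^'n \<Rightarrow> real^2^'n \<Rightarrow> real^2^'n"
    and u :: "real^2 \<Rightarrow> real^'n" and P :: "real^2 \<Rightarrow> real^2^'n" and H :: "real^2 \<Rightarrow> real^2 \<Rightarrow> real^2^'n"
    and M lam Lam mu :: real
  assumes G: "C1_deriv G A"
    and A_sym: "\<And>X Y W. A X Y \<bullet> W = A X W \<bullet> Y"
    and lam_pos: "lam > 0" and Lam_pos: "Lam > 0" and mu_pos: "mu > 0"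
    and G_bound: "\<And>X. norm (G X) \<le> M"
    and A_lower: "\<And>X Y. lam * (1 + norm X) powr (- mu) * (norm Y)\<^sup>2 \<le> A X Y \<bullet> Y"
    and A_upper: "\<And>X Y. A X Y \<bullet> Y \<le> Lam * inverse (1 + norm X) * (norm Y)\<^sup>2"
    and u: "C1_deriv u (\<lambda>x v. P x *v v)"
    and P: "C1_deriv P H"
    and div: "\<And>x i. (\<Sum>\<alpha>\<in>UNIV. A (P x) (H x (axis \<alpha> 1)) $ i $ \<alpha>) = 0"
begin

lemma A_nonneg: "0 \<le> A X Y \<bullet> Y"
  by (rule order.trans[OF _ A_lower]) (use lam_pos in simp)

lemma A_definite: "A X Y \<bullet> Y = 0 \<Longrightarrow> Y = 0"
  using A_lower[of X Y] lam_pos by (simp add: mult_le_0_iff)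
    (smt (verit) norm_ge_zero powr_gt_zero)

text \<open>Expand \<open>A X (t Y + \<delta> W) \<bullet> (t Y + \<delta> W) \<ge> 0\<close>; this needs the symmetry of \<open>A X\<close>.\<close>

lemma A_Young:
  assumes "\<delta> > 0"
  shows "- 2 * t * (A X Y \<bullet> W) \<le> t\<^sup>2 * (A X Y \<bullet> Y) / \<delta> + \<delta> * (A X W \<bullet> W)"
proof -
  have lin: "linear (A X)" by (rule C1_deriv_linear[OF G])
  have "0 \<le> A X (t *\<^sub>R Y + \<delta> *\<^sub>R W) \<bullet> (t *\<^sub>R Y + \<delta> *\<^sub>R W)" by (rule A_nonneg)
  also have "\<dots> = t\<^sup>2 * (A X Y \<bullet> Y) + 2 * t * \<delta> * (A X Y \<bullet> W) + \<delta>\<^sup>2 * (A X W \<bullet> W)"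
    using A_sym[of X W Y]
    by (simp add: linear_add[OF lin] linear_cmul[OF lin] inner_add_left inner_add_right
        power2_eq_square algebra_simps)
  finally have "0 \<le> (t\<^sup>2 * (A X Y \<bullet> Y) + 2 * t * \<delta> * (A X Y \<bullet> W) + \<delta>\<^sup>2 * (A X W \<bullet> W)) / \<delta>"
    using assms by simp
  also have "\<dots> = t\<^sup>2 * (A X Y \<bullet> Y) / \<delta> + 2 * t * (A X Y \<bullet> W) + \<delta> * (A X W \<bullet> W)"
    using assms by (simp add: field_simps power2_eq_square)
  finally show ?thesis by simp
qed

text \<open>The function \<open>t \<mapsto> G (t X) \<bullet> X\<close> is nondecreasing.  If \<open>|X| > 1\<close>, its increase over \<open>0 \<le> t \<le> 1/|X|\<close>, where
\<open>|t X| \<le> 1\<close>, is already at least \<open>\<lambda> 2\<^bsup>-\<mu>\<^esup> |X|\<close>.\<close>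

lemma G_coercive: "\<exists>k\<ge>0. \<forall>X. norm X \<le> 1 + k * ((G X - G 0) \<bullet> X)"
proof -
  define k where "k = 2 powr mu / lam"
  have k: "k > 0" using lam_pos by (simp add: k_def)
  have "norm X \<le> 1 + k * ((G X - G 0) \<bullet> X)" for X
  proof -
    define f where "f t = G (t *\<^sub>R X) \<bullet> X" for t
    have d: "(f has_real_derivative A (t *\<^sub>R X) X \<bullet> X) (at t)" for t
    proof -
      have l: "((\<lambda>t. t *\<^sub>R X) has_derivative (\<lambda>t. t *\<^sub>R X)) (at t)"
        by (auto intro!: derivative_eq_intros)
      have "((\<lambda>t. G (t *\<^sub>R X)) has_derivative (\<lambda>s. A (t *\<^sub>R X) (s *\<^sub>R X))) (at t)"
        using diff_chain_at[OF l C1_deriv_has_derivative[OF G]] by (simp add: o_def)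
      then have "(f has_derivative (\<lambda>s. A (t *\<^sub>R X) (s *\<^sub>R X) \<bullet> X)) (at t)"
        unfolding f_def by (rule has_derivative_inner_left)
      then show ?thesis
        by (simp add: has_field_derivative_def linear_cmul[OF C1_deriv_linear[OF G]] mult_commute_abs)
    qed
    have f1: "f 1 - f 0 = (G X - G 0) \<bullet> X" by (simp add: f_def inner_diff_left)
    have mono: "f s \<le> f t" if "s \<le> t" for s t
      by (rule DERIV_nonneg_imp_nondecreasing[OF that]) (use d A_nonneg in blast)
    show ?thesis
    proof (cases "norm X \<le> 1")
      case True
      moreover have "0 \<le> k * (f 1 - f 0)"
        using mono[of 0 1] k by simp
      ultimately show ?thesis by (simp add: f1)
    next
      case False
      then have X: "1 < norm X" by simp
      define h where "h = 1 / norm X"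
      have h: "0 < h" "h \<le> 1" "h * norm X = 1" using X by (auto simp: h_def divide_le_eq)
      obtain s where s: "0 < s" "s < h" and eq: "f h - f 0 = (h - 0) * (A (s *\<^sub>R X) X \<bullet> X)"
        using MVT2[OF h(1), of f "\<lambda>t. A (t *\<^sub>R X) X \<bullet> X"] d by blast
      have "s * norm X \<le> h * norm X" using s by (intro mult_right_mono) auto
      then have "norm (s *\<^sub>R X) \<le> 1" using s h by simp
      then have "2 powr (- mu) \<le> (1 + norm (s *\<^sub>R X)) powr (- mu)"
        using mu_pos by (intro powr_mono2') (auto intro: add_pos_nonneg)
      then have "lam * 2 powr (- mu) * (norm X)\<^sup>2 \<le> lam * (1 + norm (s *\<^sub>R X)) powr (- mu) * (norm X)\<^sup>2"
        using lam_pos by (intro mult_right_mono mult_left_mono) auto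
      also have "\<dots> \<le> A (s *\<^sub>R X) X \<bullet> X" by (rule A_lower)
      finally have "h * (lam * 2 powr (- mu) * (norm X)\<^sup>2) \<le> f h - f 0"
        using h by (simp add: eq)
      moreover have "h * (lam * 2 powr (- mu) * (norm X)\<^sup>2) = norm X / k"
        using X by (simp add: h_def k_def powr_minus field_simps power2_eq_square)
      ultimately have "norm X / k \<le> f 1 - f 0" using mono[OF h(2)] by linarith
      then have "norm X \<le> k * (f 1 - f 0)" using k by (simp add: field_simps)
      then show ?thesis by (simp add: f1)
    qed
  qed
  then show ?thesis using k by (intro exI[of _ k]) auto
qed

lemma flux: "C1_deriv (\<lambda>x. G (P x)) (\<lambda>x v. A (P x) (H x v))"
  by (rule C1_deriv_compose[OF P G])

lemma gradient_integral_growth: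
  assumes growth: "\<And>x. norm (u x) \<le> c * (1 + norm x)"
  shows "\<exists>K\<ge>0. \<forall>R\<ge>1. (\<integral>x. indicator (cball 0 R) x * norm (P x) \<partial>lborel) \<le> K * R\<^sup>2"
proof -
  obtain k where k: "k \<ge> 0" and coerc: "\<And>X. norm X \<le> 1 + k * ((G X - G 0) \<bullet> X)"
    using G_coercive by blast
  have c: "c \<ge> 0" using growth[of 0] order.trans[OF norm_ge_zero] by fastforce
  have M: "M \<ge> 0" using G_bound[of 0] order.trans[OF norm_ge_zero] by blast
  define V where "V x = G (P x) - G 0" for x
  have V: "C1_deriv V (\<lambda>x v. A (P x) (H x v) - 0)"
    unfolding V_def by (rule C1_deriv_diff[OF flux]) (auto intro: C1_derivI)
  have V_bound: "norm (V x) \<le> 2 * M" for x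
    using norm_triangle_ineq4[of "G (P x)" "G 0"] G_bound[of "P x"] G_bound[of 0] by (simp add: V_def)
  \<comment> \<open>\<open>192 = 2 \<cdot> 3 \<cdot> 2 \<cdot> 16\<close>, from \<open>|V| \<le> 2 M\<close>, \<open>1 + |x| \<le> 3 R\<close> on \<open>B\<^sub>2\<^sub>R\<close>, and \<open>|2 \<eta> \<nabla>\<eta>| \<le> 2 \<cdot> 16/R\<close>.\<close>
  define B where "B = 1 + k * (192 * M * c)"
  have B: "B \<ge> 0" using k M c by (simp add: B_def)
  have cP: "continuous_on UNIV P" by (rule C1_deriv_continuous[OF P])
  have "(\<integral>x. indicator (cball 0 R) x * norm (P x) \<partial>lborel) \<le> (4 * B * measure lborel (ball (0::real^2) 1)) * R\<^sup>2"
    if R: "1 \<le> R" for R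
  proof -
    obtain \<eta> :: "real^2 \<Rightarrow> real" and g where \<eta>: "C1_deriv \<eta> (\<lambda>x v. g x \<bullet> v)" "continuous_on UNIV g"
      and \<eta>01: "\<And>x. 0 \<le> \<eta> x" "\<And>x. \<eta> x \<le> 1" and in1: "\<And>x. norm x \<le> R \<Longrightarrow> \<eta> x = 1"
      and out: "\<And>x. 2 * R < norm x \<Longrightarrow> \<eta> x = 0" "\<And>x. 2 * R < norm x \<Longrightarrow> g x = 0"
      and gb: "\<And>x. norm (g x) \<le> 16 / R"
      using cutoff_exists[of R] R by (smt (verit))
    have \<eta>2: "C1_deriv (\<lambda>x. (\<eta> x)\<^sup>2) (\<lambda>x v. (2 * \<eta> x) *\<^sub>R g x \<bullet> v)"
      using C1_deriv_bounded_bilinear[OF bounded_bilinear_mult \<eta>(1) \<eta>(1)]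
      by (simp add: power2_eq_square algebra_simps)
    define T where "T x = V x \<bullet> ((\<eta> x)\<^sup>2 *\<^sub>R P x + outer (u x) ((2 * \<eta> x) *\<^sub>R g x))" for x
    have T0: "integral\<^sup>L lborel T = 0"
      unfolding T_def by (rule weak_equation[OF V _ u \<eta>2, of "2 * R"]) (use div out in auto)
    have iT: "integrable lborel T"
    proof (rule integrable_continuous_vanishing[of _ "2 * R"])
      show "continuous_on UNIV T"
        unfolding T_def
        by (intro continuous_intros cP C1_deriv_continuous[OF V] C1_deriv_continuous[OF u] \<eta>
            C1_deriv_continuous[OF \<eta>(1)] bounded_bilinear.continuous_on[OF bounded_bilinear_outer])
    qed (use out in \<open>auto simp: T_def\<close>)
    have pw: "indicator (cball 0 R) x * norm (P x) \<le> k * T x + B * indicator (cball 0 (2 * R)) x" for x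
    proof (cases "norm x \<le> 2 * R")
      case False
      then show ?thesis using R out[of x] by (simp add: T_def)
    next
      case True
      have "\<bar>V x \<bullet> outer (u x) ((2 * \<eta> x) *\<^sub>R g x)\<bar> \<le> norm (V x) * (norm (u x) * (2 * \<eta> x * norm (g x)))"
        using Cauchy_Schwarz_ineq2[of "V x" "outer (u x) ((2 * \<eta> x) *\<^sub>R g x)"] \<eta>01(1)[of x]
        by (simp add: norm_outer abs_mult)
      also have "\<dots> \<le> (2 * M) * ((c * (3 * R)) * (2 * 1 * (16 / R)))"
      proof (intro mult_mono V_bound gb \<eta>01 order_refl)
        have "c * (1 + norm x) \<le> c * (3 * R)" using True R c by (intro mult_left_mono) auto
        then show "norm (u x) \<le> c * (3 * R)" using growth[of x] by linarith
      qed (use M c R \<eta>01(1)[of x] in auto)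
      also have "\<dots> = 192 * M * c" using R by simp
      finally have b: "- (192 * M * c) \<le> V x \<bullet> outer (u x) ((2 * \<eta> x) *\<^sub>R g x)" by linarith
      have "indicator (cball 0 R) x * norm (P x) \<le> (\<eta> x)\<^sup>2 * norm (P x)"
        using in1[of x] by (auto simp: indicator_def)
      also have "\<dots> \<le> (\<eta> x)\<^sup>2 * (1 + k * (V x \<bullet> P x))"
        using coerc[of "P x"] by (intro mult_left_mono) (auto simp: V_def)
      also have "\<dots> = (\<eta> x)\<^sup>2 + k * (T x - V x \<bullet> outer (u x) ((2 * \<eta> x) *\<^sub>R g x))"
        by (simp add: T_def inner_add_right algebra_simps)
      also have "\<dots> \<le> 1 + k * (T x + 192 * M * c)"
        using b \<eta>01[of x] k by (intro add_mono mult_left_mono) (auto simp: power_le_one)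
      finally show ?thesis using True by (simp add: B_def algebra_simps)
    qed
    have iB: "integrable lborel (\<lambda>x. B * indicator (cball (0::real^2) (2 * R)) x)"
      using integrable_indicator_cball[of "\<lambda>_. B" "2 * R"] by (simp add: mult.commute)
    have "(\<integral>x. indicator (cball 0 R) x * norm (P x) \<partial>lborel)
        \<le> (\<integral>x. k * T x + B * indicator (cball 0 (2 * R)) x \<partial>lborel)"
      by (intro integral_mono Bochner_Integration.integrable_add integrable_mult_right iT iB
          integrable_indicator_cball continuous_intros cP pw)
    also have "\<dots> = k * integral\<^sup>L lborel T + B * (\<integral>x. indicator (cball (0::real^2) (2 * R)) x \<partial>lborel)"
      using iT iB by simp
    also have "\<dots> = B * ((2 * R)\<^sup>2 * measure lborel (ball (0::real^2) 1))"
      using R by (subst integral_indicator_cball) (auto simp: T0)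
    finally show ?thesis by (simp add: power_mult_distrib algebra_simps)
  qed
  then show ?thesis
    using B by (intro exI[of _ "4 * B * measure lborel (ball (0::real^2) 1)"]) auto
qed

text \<open>The Caccioppoli inequality; the dimension enters through the factor \<open>R\<^sup>2\<close> of \<open>gradient_integral_growth\<close>, which
cancels the bound \<open>256/R\<^sup>2\<close> of \<open>|\<nabla>\<eta>|\<^sup>2\<close>.\<close>

lemma second_derivatives_vanish:
  assumes growth: "\<And>x. norm (u x) \<le> c * (1 + norm x)" and e: "norm e = 1"
  shows "H x e = 0"
proof -
  obtain K where K: "K \<ge> 0"
    and Kest: "\<And>R. 1 \<le> R \<Longrightarrow> (\<integral>x. indicator (cball 0 R) x * norm (P x) \<partial>lborel) \<le> K * R\<^sup>2"
    using gradient_integral_growth[OF growth] by blast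
  define Q where "Q x = A (P x) (H x e) \<bullet> H x e" for x
  define I where "I R = (\<integral>x. indicator (cball 0 R) x * Q x \<partial>lborel)" for R
  have Q0: "0 \<le> Q x" for x unfolding Q_def by (rule A_nonneg)
  have cQ: "continuous_on UNIV Q"
    unfolding Q_def by (intro continuous_intros C1_deriv_continuous_deriv[OF flux] C1_deriv_continuous_deriv[OF P])
  have cP: "continuous_on UNIV P" by (rule C1_deriv_continuous[OF P])
  have iQ: "integrable lborel (\<lambda>x. indicator (cball 0 R) x * Q x)" for R
    by (rule integrable_indicator_cball[OF cQ])
  have iP: "integrable lborel (\<lambda>x. indicator (cball 0 R) x * norm (P x))" for R
    by (intro integrable_indicator_cball continuous_intros cP)
  \<comment> \<open>\<open>1024 = 256 \<cdot> 4\<close>, from \<open>|\<nabla>\<eta>|\<^sup>2 \<le> 256/R\<^sup>2\<close> and the integral of \<open>|P|\<close> over \<open>B\<^sub>2\<^sub>R\<close>.\<close>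
  have "I R = 0" for R
  proof (rule doubling_absorption[of I "1024 * Lam * K"])
    show "0 \<le> I R" for R unfolding I_def by (intro integral_nonneg_AE AE_I2) (simp add: Q0)
    show "I R \<le> I S" if "R \<le> S" for R S
      unfolding I_def
      by (intro integral_mono iQ mult_right_mono Q0) (use that in \<open>auto simp: indicator_def\<close>)
    show "0 \<le> 1024 * Lam * K" using Lam_pos K by simp
    fix R :: real assume R: "1 \<le> R"
    obtain \<eta> :: "real^2 \<Rightarrow> real" and g where \<eta>: "C1_deriv \<eta> (\<lambda>x v. g x \<bullet> v)" "continuous_on UNIV g"
      and \<eta>01: "\<And>x. 0 \<le> \<eta> x" "\<And>x. \<eta> x \<le> 1" and in1: "\<And>x. norm x \<le> R \<Longrightarrow> \<eta> x = 1" "\<And>x. norm x \<le> R \<Longrightarrow> g x = 0"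
      and out: "\<And>x. 2 * R < norm x \<Longrightarrow> \<eta> x = 0" "\<And>x. 2 * R < norm x \<Longrightarrow> g x = 0"
      and gb: "\<And>x. norm (g x) \<le> 16 / R"
      using cutoff_exists[of R] R by (smt (verit))
    have \<eta>2: "C1_deriv (\<lambda>x. (\<eta> x)\<^sup>2) (\<lambda>x v. (2 * \<eta> x) *\<^sub>R g x \<bullet> v)"
      using C1_deriv_bounded_bilinear[OF bounded_bilinear_mult \<eta>(1) \<eta>(1)]
      by (simp add: power2_eq_square algebra_simps)
    have c\<eta>: "continuous_on UNIV \<eta>" by (rule C1_deriv_continuous[OF \<eta>(1)])
    define T where "T x = A (P x) (H x e) \<bullet> ((\<eta> x)\<^sup>2 *\<^sub>R H x e + outer (P x *v e) ((2 * \<eta> x) *\<^sub>R g x))" for x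
    have T0: "integral\<^sup>L lborel T = 0"
      unfolding T_def
      by (rule differentiated_weak_equation[OF flux div u P \<eta>2, of "2 * R"])
        (use out in \<open>auto intro!: continuous_intros c\<eta> \<eta>\<close>)
    have iT: "integrable lborel T"
    proof (rule integrable_continuous_vanishing[of _ "2 * R"])
      show "continuous_on UNIV T"
        unfolding T_def
        by (intro continuous_intros \<eta>(2) c\<eta> C1_deriv_continuous_deriv[OF flux] C1_deriv_continuous_deriv[OF P]
            C1_deriv_continuous_deriv[OF u] bounded_bilinear.continuous_on[OF bounded_bilinear_outer])
    qed (use out in \<open>auto simp: T_def\<close>)
    have iE: "integrable lborel (\<lambda>x. (\<eta> x)\<^sup>2 * Q x)"
      by (rule integrable_continuous_vanishing[of _ "2 * R"])
        (use out in \<open>auto intro!: continuous_intros cQ c\<eta>\<close>)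
    define E where "E = (\<integral>x. (\<eta> x)\<^sup>2 * Q x \<partial>lborel)"
    have "I R \<le> E"
      unfolding I_def E_def
      by (intro integral_mono iQ iE mult_right_mono Q0) (use in1 in \<open>auto simp: indicator_def\<close>)
    moreover have "E \<le> I (2 * R)"
      unfolding I_def E_def
      by (intro integral_mono iQ iE mult_right_mono Q0)
        (use out \<eta>01 in \<open>auto simp: indicator_def power_le_one\<close>)
    moreover have "E \<le> (E - I R) / \<delta> + \<delta> * (1024 * Lam * K)" if \<delta>: "\<delta> > 0" for \<delta>
    proof -
      let ?b = "\<delta> * (Lam * (256 / R\<^sup>2))"
      have b: "0 \<le> ?b" using \<delta> Lam_pos by simp
      have pw: "(\<eta> x)\<^sup>2 * Q x \<le> T x + ((\<eta> x)\<^sup>2 * Q x - indicator (cball 0 R) x * Q x) / \<delta>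
          + ?b * (indicator (cball 0 (2 * R)) x * norm (P x))" for x
      proof (cases "norm x \<le> R")
        \<comment> \<open>Here \<open>\<eta> = 1\<close> and its gradient vanishes, so that only \<open>T x\<close> is needed.\<close>
        case True
        have "0 \<le> ?b * (indicator (cball 0 (2 * R)) x * norm (P x))"
          by (rule mult_nonneg_nonneg[OF b]) simp
        then show ?thesis using True in1[of x] by (simp add: T_def Q_def)
      next
        case False
        let ?W = "outer (P x *v e) (g x)"
        have Teq: "T x = (\<eta> x)\<^sup>2 * Q x + 2 * \<eta> x * (A (P x) (H x e) \<bullet> ?W)"
          by (simp add: T_def Q_def inner_add_right outer_scaleR_right)
        have "- 2 * \<eta> x * (A (P x) (H x e) \<bullet> ?W) \<le> (\<eta> x)\<^sup>2 * Q x / \<delta> + \<delta> * (A (P x) ?W \<bullet> ?W)"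
          unfolding Q_def by (rule A_Young[OF \<delta>])
        moreover have "A (P x) ?W \<bullet> ?W \<le> Lam * (256 / R\<^sup>2) * (indicator (cball 0 (2 * R)) x * norm (P x))"
        proof (cases "norm x \<le> 2 * R")
          case True
          have "norm ?W \<le> norm (P x) * (16 / R)"
            unfolding norm_outer using norm_matrix_vector_mult_le[of "P x" e] e gb R
            by (intro mult_mono) auto
          then have "(norm ?W)\<^sup>2 \<le> (norm (P x) * (16 / R))\<^sup>2" by (intro power_mono) auto
          then have "Lam * inverse (1 + norm (P x)) * (norm ?W)\<^sup>2
              \<le> Lam * inverse (1 + norm (P x)) * (norm (P x) * (16 / R))\<^sup>2"
            using Lam_pos by (intro mult_left_mono) auto
          also have "\<dots> = Lam * (256 / R\<^sup>2) * (inverse (1 + norm (P x)) * (norm (P x))\<^sup>2)"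
            by (simp add: power_mult_distrib power_divide)
          also have "\<dots> \<le> Lam * (256 / R\<^sup>2) * norm (P x)"
          proof (rule mult_left_mono)
            have "0 < 1 + norm (P x)" by (simp add: add_pos_nonneg)
            then show "inverse (1 + norm (P x)) * (norm (P x))\<^sup>2 \<le> norm (P x)"
              by (simp add: field_simps power2_eq_square)
          qed (use Lam_pos in simp)
          finally show ?thesis using A_upper[of "P x" ?W] True by simp
        next
          case False
          then have "?W = 0" using out(2)[of x] by simp
          then show ?thesis using False by (simp only: inner_zero_right) simp
        qed
        then have "\<delta> * (A (P x) ?W \<bullet> ?W) \<le> \<delta> * (Lam * (256 / R\<^sup>2) * (indicator (cball 0 (2 * R)) x * norm (P x)))"
          using \<delta> by (intro mult_left_mono) auto
        ultimately show ?thesis using False Teq by (simp add: mult.assoc)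
      qed
      have "E \<le> (\<integral>x. T x + ((\<eta> x)\<^sup>2 * Q x - indicator (cball 0 R) x * Q x) / \<delta>
          + ?b * (indicator (cball 0 (2 * R)) x * norm (P x)) \<partial>lborel)"
        unfolding E_def
        by (intro integral_mono iE pw Bochner_Integration.integrable_add integrable_mult_right
            integrable_divide Bochner_Integration.integrable_diff iT iQ iP)
      also have "\<dots> = (E - I R) / \<delta> + ?b * (\<integral>x. indicator (cball 0 (2 * R)) x * norm (P x) \<partial>lborel)"
        unfolding E_def I_def using iT iE iQ[of R] iP[of "2 * R"] by (simp add: T0)
      also have "\<dots> \<le> (E - I R) / \<delta> + ?b * (K * (2 * R)\<^sup>2)"
        by (intro add_left_mono mult_left_mono[OF Kest b]) (use R in simp)
      also have "?b * (K * (2 * R)\<^sup>2) = \<delta> * (1024 * Lam * K)"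
        using R by (simp add: power_mult_distrib)
      finally show ?thesis .
    qed
    ultimately show "\<exists>E. I R \<le> E \<and> E \<le> I (2 * R) \<and> (\<forall>\<delta>>0. E \<le> (E - I R) / \<delta> + \<delta> * (1024 * Lam * K))"
      by blast
  qed
  then have "(\<integral>y. indicator (cball 0 (norm x + 1)) y * Q y \<partial>lborel) = 0"
    by (simp add: I_def)
  then have "Q x = 0"
    by (rule eq_0_if_integral_cball_eq_0[OF cQ Q0]) simp
  then show ?thesis unfolding Q_def by (rule A_definite)
qed

lemma affine_if_linear_growth:
  assumes growth: "\<And>x. norm (u x) \<le> c * (1 + norm x)"
  shows "\<exists>B a. \<forall>x. u x = B *v x + a"
proof -
  have "H x v = 0" for x v
  proof (cases "v = 0")
    case True
    then show ?thesis using linear_0[OF C1_deriv_linear[OF P]] by simp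
  next
    case False
    then have "H x (v /\<^sub>R norm v) = 0"
      by (intro second_derivatives_vanish[OF growth]) simp
    then show ?thesis using False by (simp add: linear_cmul[OF C1_deriv_linear[OF P]])
  qed
  then have "H x = (\<lambda>v. 0)" for x by blast
  then have "(P has_derivative (\<lambda>v. 0)) (at x)" for x
    using C1_deriv_has_derivative[OF P, of x] by simp
  then obtain B where B: "\<And>x. P x = B"
    using has_derivative_zero_constant[of UNIV P] by auto
  have "((\<lambda>x. u x - B *v x) has_derivative (\<lambda>v. B *v v - B *v v)) (at x)" for x
    using C1_deriv_has_derivative[OF u, of x]
    by (intro has_derivative_diff bounded_linear_imp_has_derivative) (simp_all add: B)
  then obtain a where "\<And>x. u x - B *v x = a"
    using has_derivative_zero_constant[of UNIV "\<lambda>x. u x - B *v x"] by auto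
  then have "\<forall>x. u x = B *v x + a" by (metis add.commute diff_add_cancel)
  then show ?thesis by blast
qed

end

section \<open>Gradients and derivatives of twice continuously differentiable functions\<close>

lemma C2_C1_deriv:
  fixes f :: "'a::euclidean_space \<Rightarrow> 'b::euclidean_space"
  assumes "C2 f"
  obtains f' D where "\<And>x. (f has_derivative f' x) (at x)"
    "\<And>w. C1_deriv (\<lambda>x. f' x w) (\<lambda>x v. D x v w)" "\<And>x v. linear (D x v)"
proof -
  from assms obtain f1 f2 where f1: "\<And>x. (f has_derivative blinfun_apply (f1 x)) (at x)"
    and f2: "\<And>x. (f1 has_derivative blinfun_apply (f2 x)) (at x)" and c: "continuous_on UNIV f2"
    unfolding C2_def by blast
  have "C1_deriv (\<lambda>x. blinfun_apply (f1 x) w) (\<lambda>x v. blinfun_apply (blinfun_apply (f2 x) v) w)" for w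
  proof (rule C1_derivI)
    show "((\<lambda>x. blinfun_apply (f1 x) w) has_derivative
        (\<lambda>v. blinfun_apply (blinfun_apply (f2 x) v) w)) (at x)" for x
      by (rule bounded_linear.has_derivative[OF blinfun.bounded_linear_left f2])
    show "continuous_on UNIV (\<lambda>x. blinfun_apply (blinfun_apply (f2 x) v) w)" for v
      by (intro continuous_intros c)
  qed
  moreover have "linear (blinfun_apply (blinfun_apply (f2 x) v))" for x v
    by (simp add: bounded_linear.linear blinfun.bounded_linear_right)
  ultimately show ?thesis by (rule that[OF f1])
qed

lemma inner_sum_Basis_linear:
  fixes l :: "'a::euclidean_space \<Rightarrow> real"
  assumes "linear l"
  shows "w \<bullet> (\<Sum>b\<in>Basis. l b *\<^sub>R b) = l w"
proof -
  have "l w = l (\<Sum>b\<in>Basis. (w \<bullet> b) *\<^sub>R b)" by (simp add: euclidean_representation)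
  also have "\<dots> = (\<Sum>b\<in>Basis. (w \<bullet> b) * l b)"
    using assms by (simp add: linear_sum linear_cmul)
  finally show ?thesis by (simp add: inner_sum_right mult.commute)
qed

lemma grad_eq:
  fixes F :: "'a::euclidean_space \<Rightarrow> real"
  assumes "(F has_derivative l) (at Z)"
  shows "grad F Z = (\<Sum>b\<in>Basis. l b *\<^sub>R b)"
proof -
  have "linear l" using assms has_derivative_linear by blast
  then have "GDERIV F Z :> (\<Sum>b\<in>Basis. l b *\<^sub>R b)"
    using assms by (simp add: gderiv_def inner_sum_Basis_linear)
  moreover have "D = (\<Sum>b\<in>Basis. l b *\<^sub>R b)" if "GDERIV F Z :> D" for D
  proof -
    have "(\<lambda>h. h \<bullet> D) = l"
      using that assms has_derivative_unique unfolding gderiv_def by blast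
    then have "l b = D \<bullet> b" for b by (metis inner_commute)
    then show ?thesis by (simp add: euclidean_representation)
  qed
  ultimately show ?thesis unfolding grad_def by (rule the_equality)
qed

section \<open>Liouville theorems\<close>

lemma linear_growth_if_eventually:
  fixes u :: "'a::euclidean_space \<Rightarrow> 'b::real_normed_vector"
  assumes u: "continuous_on UNIV u"
    and ev: "eventually (\<lambda>x. norm (u x) / norm x \<le> C) at_infinity"
  shows "\<exists>c. \<forall>x. norm (u x) \<le> c * (1 + norm x)"
proof -
  obtain b where b: "\<And>x. b \<le> norm x \<Longrightarrow> norm (u x) / norm x \<le> C"
    using ev unfolding eventually_at_infinity by blast
  define r where "r = max b 1"
  have "compact (u ` cball 0 r)"
    by (intro compact_continuous_image compact_cball continuous_on_subset[OF u]) simp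
  then obtain B where B: "\<And>x. norm x \<le> r \<Longrightarrow> norm (u x) \<le> B"
    by (metis compact_imp_bounded bounded_iff imageI mem_cball_0)
  define c where "c = max 0 (max B C)"
  have "norm (u x) \<le> c * (1 + norm x)" for x
  proof (cases "norm x \<le> r")
    case True
    have "norm (u x) \<le> c * 1" using B[OF True] by (simp add: c_def)
    also have "\<dots> \<le> c * (1 + norm x)" by (intro mult_left_mono) (auto simp: c_def)
    finally show ?thesis .
  next
    case False
    then have "b \<le> norm x" "0 < norm x" by (auto simp: r_def)
    then have "norm (u x) \<le> C * norm x" using b[of x] by (simp add: divide_le_eq)
    also have "\<dots> \<le> c * (1 + norm x)" by (intro mult_mono) (auto simp: c_def)
    finally show ?thesis .
  qed
  then show ?thesis by blast
qed

text \<open>Evaluate the quotient along the ray through \<open>x\<close>.\<close>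

lemma affine_sublinear_imp_constant:
  fixes B :: "real^'m^'n"
  assumes lim: "((\<lambda>x. norm (B *v x + a) / norm x) \<longlongrightarrow> 0) at_infinity"
  shows "B *v x = 0"
proof (cases "x = 0")
  case False
  have inf: "filterlim (\<lambda>t. t *\<^sub>R x) at_infinity (at_top :: real filter)"
    unfolding filterlim_at_infinity[OF order_refl]
  proof (intro allI impI)
    fix r :: real assume "0 < r"
    show "eventually (\<lambda>t. r \<le> norm (t *\<^sub>R x)) at_top"
      using eventually_ge_at_top[of "r / norm x"]
      by eventually_elim (use False in \<open>simp add: divide_le_eq, smt (verit) mult_right_mono norm_ge_zero\<close>)
  qed
  have l1: "((\<lambda>t. norm (B *v (t *\<^sub>R x) + a) / norm (t *\<^sub>R x)) \<longlongrightarrow> 0) at_top"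
    by (rule filterlim_compose[OF lim inf])
  have "((\<lambda>t. norm (B *v x + inverse t *\<^sub>R a) / norm x) \<longlongrightarrow> norm (B *v x + 0 *\<^sub>R a) / norm x) at_top"
    using False by (intro tendsto_intros tendsto_inverse_0_at_top filterlim_ident) auto
  moreover have "eventually (\<lambda>t. norm (B *v (t *\<^sub>R x) + a) / norm (t *\<^sub>R x)
      = norm (B *v x + inverse t *\<^sub>R a) / norm x) at_top"
    using eventually_gt_at_top[of "0::real"]
  proof eventually_elim
    case (elim t)
    have "B *v (t *\<^sub>R x) + a = t *\<^sub>R (B *v x + inverse t *\<^sub>R a)"
      using elim by (simp add: scaleR_add_right matrix_vector_mult_scaleR)
    then show ?case using elim by simp
  qed
  ultimately have "((\<lambda>t. norm (B *v (t *\<^sub>R x) + a) / norm (t *\<^sub>R x)) \<longlongrightarrow> norm (B *v x) / norm x) at_top"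
    by (simp add: tendsto_cong)
  from tendsto_unique[OF _ this l1] show ?thesis using False by simp
qed simp

theorem theorem1p1:
  fixes F :: "real^2^'n::finite \<Rightarrow> real"
    and u :: "real^2 \<Rightarrow> real^'n"
    and M lam Lam mu :: real
  assumes "C2 F"
    and "M > 0" and "lam > 0" and "Lam > 0" and "mu > 1"
    and "\<And>Z. norm (grad F Z) \<le> M"
    and "\<And>Y Z. lam * (1 + norm Z) powr (- mu) * (norm Y)\<^sup>2 \<le> D2 F Z Y Y"
    and "\<And>Y Z. D2 F Z Y Y \<le> Lam * inverse (1 + norm Z) * (norm Y)\<^sup>2"
    and "C2 u"
    and "\<And>x. divergence (\<lambda>y. grad F (nabla u y)) x = 0"
  shows "(((\<lambda>x. norm (u x) / norm x) \<longlongrightarrow> 0) at_infinity \<longrightarrow> (\<exists>c. \<forall>x. u x = c))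
       \<and> ((SUP x. ereal (norm (nabla u x))) < \<infinity> \<longrightarrow> affine_map u)
       \<and> (Limsup at_infinity (\<lambda>x. ereal (norm (u x) / norm x)) < \<infinity> \<longrightarrow> affine_map u)"
proof -
  obtain F' D where F': "\<And>X. (F has_derivative F' X) (at X)"
    and D: "\<And>W. C1_deriv (\<lambda>X. F' X W) (\<lambda>X Y. D X Y W)" and linD: "\<And>X Y. linear (D X Y)"
    using C2_C1_deriv[OF \<open>C2 F\<close>] by blast
  define A where "A X Y = (\<Sum>b\<in>Basis. D X Y b *\<^sub>R b)" for X Y
  have A: "C1_deriv (grad F) A"
    unfolding A_def grad_eq[OF F', abs_def]
    by (intro C1_deriv_sum C1_deriv_bounded_linear[OF bounded_linear_scaleR_left] D)
  have A_inner: "A X Y \<bullet> W = D X Y W" for X Y W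
    unfolding A_def by (subst inner_commute) (rule inner_sum_Basis_linear[OF linD])
  have D2_eq: "D2 F X Y W = A X Y \<bullet> W" for X Y W
    unfolding D2_def frechet_derivative_at[OF F', symmetric]
      frechet_derivative_at[OF C1_deriv_has_derivative[OF D], symmetric] A_inner ..
  obtain u' Du where u': "\<And>x. (u has_derivative u' x) (at x)"
    and Du: "\<And>w. C1_deriv (\<lambda>x. u' x w) (\<lambda>x v. Du x v w)"
    by (rule C2_C1_deriv[OF \<open>C2 u\<close>]) (rule that)
  have nabla_mult: "nabla u x *v v = u' x v" for x v
  proof -
    have "u differentiable (at x)" using u' unfolding differentiable_def by blast
    then have "(u has_derivative (*v) (nabla u x)) (at x)" by (simp only: jacobian_works)
    from has_derivative_unique[OF this u'] show ?thesis by (rule fun_cong)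
  qed
  have nabla_eq: "nabla u = (\<lambda>x. \<Sum>\<alpha>\<in>UNIV. outer (u' x (axis \<alpha> 1)) (axis \<alpha> 1))"
  proof
    fix x
    have "(\<Sum>\<alpha>\<in>UNIV. outer (u' x (axis \<alpha> 1)) (axis \<alpha> 1)) $ i $ j
        = (\<Sum>\<alpha>\<in>UNIV. if j = \<alpha> then u' x (axis j 1) $ i else 0)" for i j
      unfolding sum_component outer_nth by (rule sum.cong) (auto simp: axis_def)
    then show "nabla u x = (\<Sum>\<alpha>\<in>UNIV. outer (u' x (axis \<alpha> 1)) (axis \<alpha> 1))"
      unfolding vec_eq_iff matrix_nth_eq[of "nabla u x"] nabla_mult by simp
  qed
  define H where "H x v = (\<Sum>\<alpha>\<in>UNIV. outer (Du x v (axis \<alpha> 1)) (axis \<alpha> 1))" for x v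
  have P: "C1_deriv (\<lambda>x. nabla u x) H"
    unfolding H_def nabla_eq
    by (intro C1_deriv_sum C1_deriv_bounded_linear[OF bounded_bilinear.bounded_linear_left[OF bounded_bilinear_outer]] Du)
  have u1: "C1_deriv u (\<lambda>x v. nabla u x *v v)"
    unfolding nabla_mult by (intro C1_derivI u' C1_deriv_continuous[OF Du])
  interpret elliptic_system "grad F" A u "\<lambda>x. nabla u x" H M lam Lam mu
  proof
    show "A X Y \<bullet> W = A X W \<bullet> Y" for X Y W
      unfolding A_inner by (rule second_derivative_symmetric[OF F' D])
    show "(\<Sum>\<alpha>\<in>UNIV. A (nabla u x) (H x (axis \<alpha> 1)) $ i $ \<alpha>) = 0" for x i
    proof -
      have "((\<lambda>y. grad F (nabla u y) $ i $ \<alpha>) has_derivative (\<lambda>v. A (nabla u x) (H x v) $ i $ \<alpha>)) (at x)" for \<alpha>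
        by (rule C1_deriv_has_derivative)
          (intro C1_deriv_bounded_linear[OF bounded_linear_vec_nth] C1_deriv_compose[OF P A])
      then have "partial \<alpha> (\<lambda>y. grad F (nabla u y) $ i $ \<alpha>) x = A (nabla u x) (H x (axis \<alpha> 1)) $ i $ \<alpha>" for \<alpha>
        unfolding partial_def by (rule fun_cong[OF frechet_derivative_at, symmetric])
      then show ?thesis
        using arg_cong[OF assms(10)[of x], of "\<lambda>z. z $ i"] by (simp add: divergence_def)
    qed
  qed (use assms A P u1 in \<open>auto simp flip: D2_eq\<close>)
  have cu: "continuous_on UNIV u" by (rule C1_deriv_continuous[OF u1])
  have affine: "affine_map u" if "eventually (\<lambda>x. norm (u x) / norm x \<le> C) at_infinity" for C
    using linear_growth_if_eventually[OF cu that] affine_if_linear_growth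
    unfolding affine_map_def by metis
  show ?thesis
  proof (intro conjI impI)
    assume lim: "((\<lambda>x. norm (u x) / norm x) \<longlongrightarrow> 0) at_infinity"
    then have "eventually (\<lambda>x. norm (u x) / norm x < 1) at_infinity"
      by (rule order_tendstoD) simp
    then have "affine_map u" by (intro affine[of 1]) (auto elim: eventually_mono)
    then obtain B a where u_eq: "\<And>x. u x = B *v x + a" unfolding affine_map_def by blast
    with lim have "B *v x = 0" for x
      by (intro affine_sublinear_imp_constant[of B a]) simp
    then show "\<exists>c. \<forall>x. u x = c" using u_eq by auto
  next
    assume "(SUP x. ereal (norm (nabla u x))) < \<infinity>"
    then obtain C where C: "(SUP x. ereal (norm (nabla u x))) < ereal C"
      using less_PInf_Ex_of_nat by (metis less_irrefl)
    have nb: "norm (nabla u x) \<le> C" for x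
    proof -
      have "ereal (norm (nabla u x)) \<le> (SUP x. ereal (norm (nabla u x)))" by (rule SUP_upper) simp
      with C have "ereal (norm (nabla u x)) \<le> ereal C" by (meson le_less_trans less_imp_le)
      then show ?thesis by simp
    qed
    have "norm (u x) \<le> max (norm (u 0)) C * (1 + norm x)" for x
    proof -
      have "norm (u x - u 0) \<le> C * norm (x - 0)"
      proof (rule differentiable_bound[OF convex_UNIV])
        show "(u has_derivative (\<lambda>v. nabla u y *v v)) (at y within UNIV)" for y
          using C1_deriv_has_derivative[OF u1] by simp
        show "onorm (\<lambda>v. nabla u y *v v) \<le> C" for y
          by (rule onorm_le) (meson nb norm_matrix_vector_mult_le mult_right_mono norm_ge_zero order.trans)
      qed auto
      then have "norm (u x) \<le> norm (u 0) + C * norm x"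
        using norm_triangle_sub[of "u x" "u 0"] by simp
      also have "\<dots> \<le> max (norm (u 0)) C + max (norm (u 0)) C * norm x"
        by (intro add_mono mult_right_mono) auto
      finally show ?thesis by (simp add: algebra_simps)
    qed
    then show "affine_map u" unfolding affine_map_def by (rule affine_if_linear_growth)
  next
    assume "Limsup at_infinity (\<lambda>x. ereal (norm (u x) / norm x)) < \<infinity>"
    then obtain C where "Limsup at_infinity (\<lambda>x. ereal (norm (u x) / norm x)) < ereal C"
      using less_PInf_Ex_of_nat by (metis less_irrefl)
    then have "eventually (\<lambda>x. ereal (norm (u x) / norm x) < ereal C) at_infinity"
      by (rule Limsup_lessD)
    then show "affine_map u" by (intro affine[of C]) (auto elim: eventually_mono)
  qed
qed

end
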